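(* Let $m\ge2$, $\mathcal{A}_m=\{\alpha_1,\dots,\alpha_m\}$, and let $X=(X_i)_{1\le i\le n}$, $Y=(Y_i)_{1\le i\le n}$ be independent, each with i.i.d. letters in $\mathcal{A}_m$ with $\mathbb{P}(X_1=\alpha_k)=\mathbb{P}(Y_1=\alpha_k)=p_k$. Suppose $p_{j_0}>1/2$ for some $j_0$, let $K=\min(2^{-4}10^{-2}e^{-67},\,1/(800m))$, and suppose $\max_{j\ne j_0}p_j\le\min\left(2^{-2}e^{-5}K/m,\ K/(2m^2)\right)$. Let $(\tilde X,\tilde Y)$ be obtained from $(X,Y)$ by choosing, uniformly at random (independently of everything else given $(X,Y)$), one position among all positions of $X$ and of $Y$ carrying a letter different from $\alpha_{j_0}$, and replacing that letter by $\alpha_{j_0}$. Let $LC_n$ and $\widetilde{LC_n}$ be the lengths of the longest common subsequences of $(X,Y)$ and of $(\tilde X,\tilde Y)$, respectively. Then for all $n\ge1$ there exists a set $\mathcal{B}_n\subset\mathcal{A}_m^n\times\mathcal{A}_m^n$ such that \[ \mathbb{P}\big((X,Y)\in\mathcal{B}_n\big)\ge 1-121\exp\left(-\frac{n(\max_{j\ne j_0}p_j)^6}{5}\right), \] and such that for all $(x,y)\in\mathcal{B}_n$, \[ \mathbb{P}(\widetilde{LC_n}-LC_n=1\mid X=x,Y=y)\ge\frac{K}{m},\qquad \mathbb{P}(\widetilde{LC_n}-LC_n=-1\mid X=x,Y=y)\le\frac{K}{2m}. \]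
   Context: The length of the longest common subsequence of two words $x_1\cdots x_n$ and $y_1\cdots y_n$ is the largest $k$ such that there exist $1\le i_1<\dots<i_k\le n$ and $1\le j_1<\dots<j_k\le n$ with $x_{i_s}=y_{j_s}$ for all $s$. *)

theory Defs
  imports Complex_Main
begin

text \<open>Alphabet A_m = {0,...,m-1} (letter alpha_k is encoded as k-1).
 Words of length n are lists of length n over this alphabet.\<close>

definition words :: "nat \<Rightarrow> nat \<Rightarrow> nat list set" where
  "words m n = {xs. length xs = n \<and> set xs \<subseteq> {..<m}}"

definition is_common_subseq_len :: "'a list \<Rightarrow> 'a list \<Rightarrow> nat \<Rightarrow> bool" where
  "is_common_subseq_len xs ys k \<longleftrightarrow>
     (\<exists>f g :: nat \<Rightarrow> nat.
        (\<forall>s t. s < t \<and> t < k \<longrightarrow> f s < f t \<and> g s < g t) \<and>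
        (\<forall>s<k. f s < length xs \<and> g s < length ys \<and> xs ! (f s) = ys ! (g s)))"

definition lcs_len :: "'a list \<Rightarrow> 'a list \<Rightarrow> nat" where
  "lcs_len xs ys = Max {k. is_common_subseq_len xs ys k}"

definition word_prob :: "(nat \<Rightarrow> real) \<Rightarrow> nat list \<Rightarrow> real" where
  "word_prob p xs = (\<Prod>i<length xs. p (xs ! i))"

definition pair_prob :: "(nat \<Rightarrow> real) \<Rightarrow> (nat list \<times> nat list) set \<Rightarrow> real" where
  "pair_prob p B = (\<Sum>(x, y)\<in>B. word_prob p x * word_prob p y)"

definition positions :: "nat \<Rightarrow> nat list \<Rightarrow> nat list \<Rightarrow> (bool \<times> nat) set" where
  "positions j0 x y =
     {(b, i). (\<not> b \<and> i < length x \<and> x ! i \<noteq> j0) \<or> (b \<and> i < length y \<and> y ! i \<noteq> j0)}"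

definition perturb :: "nat \<Rightarrow> nat list \<Rightarrow> nat list \<Rightarrow> bool \<times> nat \<Rightarrow> nat list \<times> nat list" where
  "perturb j0 x y s = (if fst s then (x, y[snd s := j0]) else (x[snd s := j0], y))"

text \<open>P(tilde LC_n - LC_n = d | X = x, Y = y), the position being uniform on positions j0 x y.
 (If there is no such position the ratio is 0/0 = 0.)\<close>

definition lcs_change_prob :: "nat \<Rightarrow> nat list \<Rightarrow> nat list \<Rightarrow> int \<Rightarrow> real" where
  "lcs_change_prob j0 x y d =
     real (card {s \<in> positions j0 x y.
               int (lcs_len (fst (perturb j0 x y s)) (snd (perturb j0 x y s))) - int (lcs_len x y) = d})
     / real (card (positions j0 x y))"

definition pmax_other :: "nat \<Rightarrow> (nat \<Rightarrow> real) \<Rightarrow> nat \<Rightarrow> real" where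
  "pmax_other m p j0 = Max (p ` ({..<m} - {j0}))"

definition Kconst :: "nat \<Rightarrow> real" where
  "Kconst m = min (2 powr (-4) * 10 powr (-2) * exp (-67)) (1 / (800 * real m))"

end

theory Submission
  imports Defs "HOL-Library.Sublist"
begin

text \<open>Fix an alignment of \<open>x\<close> and \<open>y\<close> realizing the longest common subsequence. The matched minority
  letters (those different from \<open>j0\<close>) cut \<open>x\<close> and \<open>y\<close> into paired segments; inside a
  pair only majority letters are matched, so with \<open>k\<close> cuts the score is \<open>k\<close> plus the sum of
  the minima of the majority counts. Replacing an unmatched minority letter in a segment that has
  fewer majority letters than its partner gains one, and only replacing one of the \<open>2 k\<close> matched
  minority letters can lose one. Comparing with the score of the trivial alignment bounds the
  total imbalance of the segment pairs by \<open>2 k\<close> plus the global imbalance.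

  If \<open>k\<close> is chosen maximal, a balanced segment pair has no common minority letter at
  majority-offset \<open>0\<close> or \<open>\<plusminus> 1\<close>, as matching it would keep the score and raise \<open>k\<close>. A union bound
  over alignments then controls both bad events. Write \<open>\<rho>\<close> for the sum of the squared
  probabilities of the minority letters. Alignments with many cuts are unlikely, since each cut
  costs a factor \<open>\<rho>\<close>. If few replacements gain one, then almost everything lies in balanced
  pairs, where the absence of common letters at the offsets \<open>0, \<plusminus> 1\<close> has exponential rate about
  \<open>2 \<rho>\<close> at least, beating the entropy rate \<open>\<rho>\<close> of the choice of the cuts.\<close>

section \<open>Common subsequences\<close>

text \<open>The prefix \<open>take l xs\<close> makes the induction on \<open>k\<close> work: the
  last index \<open>f k\<close> exceeds all earlier ones, so it serves as the new
  \<open>l\<close>.\<close>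

lemma subseq_map_nth:
  assumes "\<And>s t. s < t \<Longrightarrow> t < k \<Longrightarrow> f s < (f t :: nat)" "\<And>s. s < k \<Longrightarrow> f s < l" "l \<le> length xs"
  shows "subseq (map (\<lambda>s. xs ! f s) [0..<k]) (take l xs)"
  using assms
proof (induction k arbitrary: l)
  case (Suc k)
  have "subseq (map (\<lambda>s. xs ! f s) [0..<k]) (take (f k) xs)"
    using Suc.prems(1,3) Suc.prems(2)[of k] by (intro Suc.IH) auto
  hence "subseq (map (\<lambda>s. xs ! f s) [0..<k] @ [xs ! f k]) (take (f k) xs @ [xs ! f k])"
    by (rule list_emb_append_mono) auto
  also have "take (f k) xs @ [xs ! f k] = take (Suc (f k)) xs"
    using Suc.prems(2)[of k] Suc.prems(3) by (simp add: take_Suc_conv_app_nth)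
  also have "subseq (take (Suc (f k)) xs) (take l xs)"
    by (metis Suc.prems(2) Suc_leI lessI prefix_imp_subseq take_is_prefix take_take min.absorb1)
  finally show ?case by simp
qed auto

lemma subseq_imp_embedding:
  assumes "subseq zs xs"
  shows "\<exists>f :: nat \<Rightarrow> nat. (\<forall>s t. s < t \<and> t < length zs \<longrightarrow> f s < f t) \<and>
           (\<forall>s < length zs. f s < length xs \<and> zs ! s = xs ! f s)"
  using assms
proof (induction rule: list_emb.induct)
  case (list_emb_Cons xs ys y)
  then obtain f where "\<forall>s t. s < t \<and> t < length xs \<longrightarrow> f s < f t"
    "\<forall>s < length xs. f s < length ys \<and> xs ! s = ys ! f s" by blast
  thus ?case by (intro exI[of _ "\<lambda>s. Suc (f s)"]) auto
next
  case (list_emb_Cons2 x y xs ys)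
  then obtain f where "\<forall>s t. s < t \<and> t < length xs \<longrightarrow> f s < f t"
    "\<forall>s < length xs. f s < length ys \<and> xs ! s = ys ! f s" by blast
  thus ?case using list_emb_Cons2.hyps
    by (intro exI[of _ "\<lambda>s. case s of 0 \<Rightarrow> 0 | Suc s' \<Rightarrow> Suc (f s')"])
       (auto split: nat.splits simp: nth_Cons')
qed auto

text \<open>Replaces pairs of increasing index functions by a common word \<open>zs\<close>, which
  can be cut and reassembled along concatenations.\<close>

lemma is_common_subseq_len_iff:
  "is_common_subseq_len xs ys k \<longleftrightarrow> (\<exists>zs. subseq zs xs \<and> subseq zs ys \<and> length zs = k)"
proof
  assume "is_common_subseq_len xs ys k"
  then obtain f g where fg: "\<And>s t. s < t \<Longrightarrow> t < k \<Longrightarrow> f s < f t" "\<And>s t. s < t \<Longrightarrow> t < k \<Longrightarrow> g s < g t"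
    "\<And>s. s < k \<Longrightarrow> f s < length xs" "\<And>s. s < k \<Longrightarrow> g s < length ys"
    "\<And>s. s < k \<Longrightarrow> xs ! f s = ys ! g s"
    unfolding is_common_subseq_len_def by blast
  have "map (\<lambda>s. xs ! f s) [0..<k] = map (\<lambda>s. ys ! g s) [0..<k]"
    using fg(5) by simp
  moreover have "subseq (map (\<lambda>s. xs ! f s) [0..<k]) xs"
    using subseq_map_nth[of k f "length xs" xs] fg by auto
  moreover have "subseq (map (\<lambda>s. ys ! g s) [0..<k]) ys"
    using subseq_map_nth[of k g "length ys" ys] fg by auto
  ultimately show "\<exists>zs. subseq zs xs \<and> subseq zs ys \<and> length zs = k"
    by (metis diff_zero length_map length_upt)
next
  assume "\<exists>zs. subseq zs xs \<and> subseq zs ys \<and> length zs = k"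
  then obtain zs where zs: "subseq zs xs" "subseq zs ys" "length zs = k" by blast
  from subseq_imp_embedding[OF zs(1)] subseq_imp_embedding[OF zs(2)] zs(3)
  show "is_common_subseq_len xs ys k"
    unfolding is_common_subseq_len_def by metis
qed

lemma finite_common_subseq_lens: "finite {k. is_common_subseq_len xs ys k}"
  by (rule finite_subset[of _ "{..length xs}"])
     (auto simp: is_common_subseq_len_iff dest: list_emb_length)

lemma lcs_len_ge: "subseq zs xs \<Longrightarrow> subseq zs ys \<Longrightarrow> length zs \<le> lcs_len xs ys"
  unfolding lcs_len_def
  by (intro Max_ge finite_common_subseq_lens) (auto simp: is_common_subseq_len_iff)

lemma lcs_len_witness: "\<exists>zs. subseq zs xs \<and> subseq zs ys \<and> length zs = lcs_len xs ys"
proof -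
  have "is_common_subseq_len xs ys 0" by (auto simp: is_common_subseq_len_def)
  hence "lcs_len xs ys \<in> {k. is_common_subseq_len xs ys k}"
    unfolding lcs_len_def using finite_common_subseq_lens by (intro Max_in) auto
  thus ?thesis by (simp add: is_common_subseq_len_iff)
qed

lemma lcs_len_commute: "lcs_len xs ys = lcs_len ys xs"
  using lcs_len_witness lcs_len_ge by (metis order_antisym)

text \<open>Cut a longest common subsequence where \<open>x1\<close> ends. Without its head, the
  second piece embeds into \<open>x2\<close> alone, so avoiding the letter \<open>c\<close> costs at
  most one letter.\<close>

lemma lcs_len_substitute: "lcs_len (x1 @ c # x2) ys \<le> Suc (lcs_len (x1 @ b # x2) ys)"
proof -
  obtain zs where zs: "subseq zs (x1 @ c # x2)" "subseq zs ys" "length zs = lcs_len (x1 @ c # x2) ys"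
    using lcs_len_witness by blast
  obtain z1 z2 where z: "zs = z1 @ z2" "subseq z1 x1" "subseq z2 (c # x2)"
    using zs(1) by (auto simp: subseq_append_iff)
  have "subseq (tl z2) x2"
    using z(3) by (cases z2) (auto dest: list_emb_ConsD split: if_splits elim: subseq_Cons')
  hence "subseq (z1 @ tl z2) (x1 @ b # x2)"
    using z(2) by (intro list_emb_append_mono) auto
  moreover have "subseq (tl z2) z2" by (cases z2) auto
  hence "subseq (z1 @ tl z2) ys"
    using z(1) zs(2) by (metis list_emb_append_mono subseq_order.order_refl subseq_order.order_trans)
  ultimately have "length (z1 @ tl z2) \<le> lcs_len (x1 @ b # x2) ys" by (rule lcs_len_ge)
  thus ?thesis using z(1) zs(3) by simp
qed

section \<open>Decompositions along matched minority letters\<close>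

abbreviation ones :: "'a \<Rightarrow> 'a list \<Rightarrow> nat" where
  "ones j u \<equiv> count_list u j"

definition minor :: "'a \<Rightarrow> 'a list \<Rightarrow> nat" where
  "minor j u = length (filter (\<lambda>c. c \<noteq> j) u)"

lemma minor_simps [simp]:
  "minor j [] = 0" "minor j (c # u) = (if c = j then 0 else 1) + minor j u"
  "minor j (u @ v) = minor j u + minor j v"
  by (auto simp: minor_def)

lemma ones_add_minor: "ones j u + minor j u = length u"
  by (induction u) auto

text \<open>A pair of words with distinguished matched minority letters, \<open>x = u\<^sub>0 c\<^sub>1 u\<^sub>1 \<dots> c\<^sub>k u\<^sub>k\<close> and
  \<open>y = v\<^sub>0 c\<^sub>1 v\<^sub>1 \<dots> c\<^sub>k v\<^sub>k\<close>, is stored as the list of the \<open>(u\<^sub>i, c\<^sub>i\<^sub>+\<^sub>1, v\<^sub>i)\<close> together with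
  the two final segments \<open>e = u\<^sub>k\<close> and \<open>e' = v\<^sub>k\<close>.\<close>

type_synonym 'a seg = "'a list \<times> 'a \<times> 'a list"

fun lword :: "'a seg list \<Rightarrow> 'a list \<Rightarrow> 'a list" where
  "lword [] e = e"
| "lword ((u, c, v) # ds) e = u @ c # lword ds e"

fun rword :: "'a seg list \<Rightarrow> 'a list \<Rightarrow> 'a list" where
  "rword [] e = e"
| "rword ((u, c, v) # ds) e = v @ c # rword ds e"

fun score :: "'a \<Rightarrow> 'a seg list \<Rightarrow> 'a list \<Rightarrow> 'a list \<Rightarrow> nat" where
  "score j [] e e' = min (ones j e) (ones j e')"
| "score j ((u, c, v) # ds) e e' = Suc (min (ones j u) (ones j v) + score j ds e e')"

lemma subseq_replicate: "k \<le> ones j u \<Longrightarrow> subseq (replicate k j) u"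
proof (induction u arbitrary: k)
  case (Cons c u)
  show ?case
  proof (cases "c = j \<and> k \<noteq> 0")
    case True
    then obtain k' where "k = Suc k'" by (cases k) auto
    thus ?thesis using Cons True by auto
  next
    case False
    thus ?thesis using Cons.IH[of k] Cons.prems by (auto split: if_splits)
  qed
qed auto

lemma score_le_lcs: "score j ds e e' \<le> lcs_len (lword ds e) (rword ds e')"
proof -
  have "\<exists>zs. subseq zs (lword ds e) \<and> subseq zs (rword ds e') \<and> length zs = score j ds e e'"
  proof (induction ds)
    case Nil
    thus ?case
      by (intro exI[of _ "replicate (min (ones j e) (ones j e')) j"]) (auto intro: subseq_replicate)
  next
    case (Cons d ds)
    obtain u c v where d: "d = (u, c, v)" by (cases d)
    obtain zs where "subseq zs (lword ds e)" "subseq zs (rword ds e')" "length zs = score j ds e e'"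
      using Cons by blast
    thus ?case unfolding d
      by (intro exI[of _ "replicate (min (ones j u) (ones j v)) j @ c # zs"])
         (auto intro!: list_emb_append_mono subseq_replicate)
  qed
  thus ?thesis using lcs_len_ge by metis
qed

abbreviation matched_minor :: "'a \<Rightarrow> 'a seg list \<Rightarrow> bool" where
  "matched_minor j ds \<equiv> \<forall>(u, c, v)\<in>set ds. c \<noteq> j"

text \<open>Read \<open>zs\<close> letter by letter: a minority letter becomes a cut, a majority
  letter is absorbed into the segment pair that follows it. Only an inequality results, since the
  segments may hold further majority letters.\<close>

lemma common_subseq_decomposition:
  assumes "subseq zs x" "subseq zs y"
  shows "\<exists>ds e e'. x = lword ds e \<and> y = rword ds e' \<and> matched_minor j ds \<and> length zs \<le> score j ds e e'"
  using assms
proof (induction zs arbitrary: x y)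
  case Nil
  thus ?case by (intro exI[of _ "[]"] exI[of _ x] exI[of _ y]) auto
next
  case (Cons c zs)
  obtain x1 x2 where x: "x = x1 @ c # x2" "subseq zs x2"
    using list_emb_ConsD[OF Cons.prems(1)] by auto
  obtain y1 y2 where y: "y = y1 @ c # y2" "subseq zs y2"
    using list_emb_ConsD[OF Cons.prems(2)] by auto
  obtain ds e e' where IH: "x2 = lword ds e" "y2 = rword ds e'" "matched_minor j ds"
    "length zs \<le> score j ds e e'"
    using Cons.IH[OF x(2) y(2)] by blast
  show ?case
  proof (cases "c = j")
    case False
    thus ?thesis using IH x y
      by (intro exI[of _ "(x1, c, y1) # ds"] exI[of _ e] exI[of _ e']) auto
  next
    case True
    show ?thesis
    proof (cases ds)
      case Nil
      thus ?thesis using IH x y True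
        by (intro exI[of _ "[]"] exI[of _ "x1 @ c # e"] exI[of _ "y1 @ c # e'"]) auto
    next
      case (Cons d ds')
      obtain u b v where "d = (u, b, v)" by (cases d)
      thus ?thesis using IH x y True Cons
        by (intro exI[of _ "(x1 @ c # u, b, y1 @ c # v) # ds'"] exI[of _ e] exI[of _ e']) auto
    qed
  qed
qed

section \<open>Effect of replacing one minority letter\<close>

fun swap_segs :: "'a seg list \<Rightarrow> 'a seg list" where
  "swap_segs [] = []"
| "swap_segs ((u, c, v) # ds) = (v, c, u) # swap_segs ds"

lemma swap_segs_simps [simp]:
  "lword (swap_segs ds) e = rword ds e" "rword (swap_segs ds) e = lword ds e"
  "score j (swap_segs ds) e' e = score j ds e e'" "length (swap_segs ds) = length ds"
  by (induction ds rule: swap_segs.induct) auto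

text \<open>Recursive form of the count in \<open>flips_card\<close>. Passing the context into the
  predicate lets the count split along concatenations, hence along segments.\<close>

fun flips :: "'a \<Rightarrow> ('a list \<Rightarrow> bool) \<Rightarrow> 'a list \<Rightarrow> nat" where
  "flips j P [] = 0"
| "flips j P (c # x) = (if c \<noteq> j \<and> P (j # x) then 1 else 0) + flips j (\<lambda>z. P (c # z)) x"

lemma flips_card: "flips j P x = card {i. i < length x \<and> x ! i \<noteq> j \<and> P (x[i := j])}"
proof (induction x arbitrary: P)
  case (Cons c x)
  let ?A = "{i. i < length x \<and> x ! i \<noteq> j \<and> P (c # x[i := j])}"
  have "{i. i < length (c # x) \<and> (c # x) ! i \<noteq> j \<and> P ((c # x)[i := j])} =
      (if c \<noteq> j \<and> P (j # x) then {0} else {}) \<union> Suc ` ?A" (is "?L = ?R")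
  proof (rule set_eqI)
    fix i show "i \<in> ?L \<longleftrightarrow> i \<in> ?R" by (cases i) auto
  qed
  moreover have "card ?R = (if c \<noteq> j \<and> P (j # x) then 1 else 0) + card ?A"
    by (subst card_Un_disjoint) (auto simp: card_image)
  ultimately show ?case by (simp add: Cons.IH)
qed auto

lemma flips_append:
  "flips j P (x @ y) = flips j (\<lambda>z. P (z @ y)) x + flips j (\<lambda>z. P (x @ z)) y"
  by (induction x arbitrary: P) auto

lemma flips_mono: "(\<And>z. P z \<Longrightarrow> Q z) \<Longrightarrow> flips j P x \<le> flips j Q x"
proof (induction x arbitrary: P Q)
  case (Cons c x)
  have "flips j (\<lambda>z. P (c # z)) x \<le> flips j (\<lambda>z. Q (c # z)) x"
    using Cons.prems by (intro Cons.IH) auto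
  thus ?case using Cons.prems by auto
qed auto

text \<open>Each replacement adds exactly one majority letter, so \<open>P\<close> has to be checked
  only on words with that count.\<close>

lemma flips_all: "(\<And>z. ones j z = Suc (ones j x) \<Longrightarrow> P z) \<Longrightarrow> flips j P x = minor j x"
proof (induction x arbitrary: P)
  case (Cons c x)
  have "flips j (\<lambda>z. P (c # z)) x = minor j x"
    by (rule Cons.IH) (rule Cons.prems, auto)
  moreover have "c \<noteq> j \<Longrightarrow> P (j # x)" by (rule Cons.prems) auto
  ultimately show ?case by auto
qed auto

lemma flips_none: "(\<And>z. ones j x \<le> ones j z \<Longrightarrow> \<not> P z) \<Longrightarrow> flips j P x = 0"
proof (induction x arbitrary: P)
  case (Cons c x)
  have "flips j (\<lambda>z. P (c # z)) x = 0"
    by (rule Cons.IH) (rule Cons.prems, auto)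
  moreover have "c \<noteq> j \<Longrightarrow> \<not> P (j # x)" by (rule Cons.prems) auto
  ultimately show ?case by auto
qed auto

fun deficit :: "'a \<Rightarrow> 'a seg list \<Rightarrow> 'a list \<Rightarrow> 'a list \<Rightarrow> nat" where
  "deficit j [] e e' = (if ones j e < ones j e' then minor j e else 0)"
| "deficit j ((u, c, v) # ds) e e' = (if ones j u < ones j v then minor j u else 0) + deficit j ds e e'"

text \<open>A lower bound for the longest common subsequence, with a decomposition as its witness.
  The final segment \<open>e'\<close> of \<open>y\<close> stays fixed, so that segment pairs can be
  prepended one at a time.\<close>

definition reaches :: "'a \<Rightarrow> 'a list \<Rightarrow> 'a list \<Rightarrow> nat \<Rightarrow> 'a list \<Rightarrow> bool" where
  "reaches j e' y k z \<longleftrightarrow> (\<exists>ds e. z = lword ds e \<and> y = rword ds e' \<and> k \<le> score j ds e e')"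

lemma reaches_lcs: "reaches j e' y k z \<Longrightarrow> k \<le> lcs_len z y"
  unfolding reaches_def using score_le_lcs order_trans by metis

lemma reaches_Nil: "k \<le> min (ones j z) (ones j e') \<Longrightarrow> reaches j e' e' k z"
  unfolding reaches_def by (intro exI[of _ "[]"] exI[of _ z]) auto

lemma reaches_Cons:
  "reaches j e' y k z \<Longrightarrow> l \<le> Suc (min (ones j u) (ones j v)) + k \<Longrightarrow>
     reaches j e' (v @ c # y) l (u @ c # z)"
  unfolding reaches_def
  by (elim exE, rename_tac ds e, rule_tac x = "(u, c, v) # ds" in exI, rule_tac x = e in exI) auto

lemma reaches_self: "k \<le> score j ds e e' \<Longrightarrow> reaches j e' (rword ds e') k (lword ds e)"
  unfolding reaches_def by blast

text \<open>In a segment with fewer majority letters than its partner, a replacement raises the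
  minimum by one, while the other segments and all cuts stay in place.\<close>

lemma deficit_le_flips:
  "deficit j ds e e' \<le> flips j (reaches j e' (rword ds e') (Suc (score j ds e e'))) (lword ds e)"
proof (induction j ds e e' rule: deficit.induct)
  case (1 j e e')
  have "flips j (reaches j e' e' (Suc (min (ones j e) (ones j e')))) e = minor j e"
    if "ones j e < ones j e'"
    using that by (intro flips_all reaches_Nil) auto
  thus ?case by auto
next
  case (2 j u c v ds e e')
  let ?R = "reaches j e' (v @ c # rword ds e') (Suc (score j ((u, c, v) # ds) e e'))"
  have a: "flips j (\<lambda>z. ?R (z @ c # lword ds e)) u = minor j u" if "ones j u < ones j v"
    using that by (intro flips_all reaches_Cons[OF reaches_self[OF order_refl]]) auto
  have b: "deficit j ds e e' \<le> flips j (\<lambda>z. ?R (u @ c # z)) (lword ds e)"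
    by (rule order_trans[OF 2 flips_mono]) (erule reaches_Cons, simp)
  show ?case using a b by (auto simp: flips_append)
qed

text \<open>A replacement inside a segment cannot lower its minimum, so only the
  \<open>length ds\<close> matched letters at the cuts can spoil the score.\<close>

lemma flips_not_reaches:
  "flips j (\<lambda>z. \<not> reaches j e' (rword ds e') (score j ds e e') z) (lword ds e) \<le> length ds"
proof (induction j ds e e' rule: deficit.induct)
  case (1 j e e')
  have "flips j (\<lambda>z. \<not> reaches j e' e' (min (ones j e) (ones j e')) z) e = 0"
    by (intro flips_none) (auto intro!: reaches_Nil)
  thus ?case by auto
next
  case (2 j u c v ds e e')
  let ?R = "reaches j e' (v @ c # rword ds e') (score j ((u, c, v) # ds) e e')"
  have a: "flips j (\<lambda>z. \<not> ?R (z @ c # lword ds e)) u = 0"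
    by (intro flips_none) (auto intro!: reaches_Cons[OF reaches_self[OF order_refl]])
  have b: "flips j (\<lambda>z. \<not> ?R (u @ c # z)) (lword ds e) \<le> length ds"
    by (rule order_trans[OF flips_mono 2]) (erule contrapos_nn, erule reaches_Cons, simp)
  show ?case using a b by (auto simp: flips_append)
qed

section \<open>Optimal decompositions with the most cuts\<close>

definition barren :: "'a \<Rightarrow> 'a list \<Rightarrow> 'a list \<Rightarrow> bool" where
  "barren j u v \<longleftrightarrow> \<not> (\<exists>u1 c u2 v1 v2. u = u1 @ c # u2 \<and> v = v1 @ c # v2 \<and> c \<noteq> j \<and>
     ones j u1 \<le> Suc (ones j v1) \<and> ones j v1 \<le> Suc (ones j u1))"

abbreviation admissible :: "'a \<Rightarrow> 'a list \<Rightarrow> 'a list \<Rightarrow> bool" where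
  "admissible j u v \<equiv> ones j u = ones j v \<longrightarrow> barren j u v"

lemma lword_append: "lword (ds1 @ ds2) e = lword ds1 (lword ds2 e)"
  by (induction ds1 e rule: lword.induct) auto

lemma rword_append: "rword (ds1 @ ds2) e = rword ds1 (rword ds2 e)"
  by (induction ds1 e rule: rword.induct) auto

lemma score_append:
  "score j (ds1 @ ds2) e e' =
     sum_list (map (\<lambda>(u, c, v). Suc (min (ones j u) (ones j v))) ds1) + score j ds2 e e'"
  by (induction ds1) auto

lemma length_le_lword: "length ds \<le> length (lword ds e)"
  by (induction ds e rule: lword.induct) auto

lemma lcs_decomposition:
  "\<exists>ds e e'. x = lword ds e \<and> y = rword ds e' \<and> matched_minor j ds \<and>
     score j ds e e' = lcs_len x y \<and> (\<forall>(u, c, v)\<in>set ds. admissible j u v) \<and> admissible j e e'"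
proof -
  define Q where "Q = (\<lambda>(ds, e, e'). x = lword ds e \<and> y = rword ds e' \<and> matched_minor j ds \<and>
     lcs_len x y \<le> score j ds e e')"
  obtain zs where "subseq zs x" "subseq zs y" "length zs = lcs_len x y"
    using lcs_len_witness by blast
  then obtain D where D: "Q D"
    using common_subseq_decomposition[of zs x y j] unfolding Q_def by fastforce
  \<comment> \<open>The number of cuts is at most \<open>length x\<close>, so the maximum
    exists.\<close>
  have "\<exists>D. Q D \<and> (\<forall>E. Q E \<longrightarrow> length (fst E) \<le> length (fst D))"
    using D by (rule ex_has_greatest_nat[of Q _ _ "length x + 1"])
               (auto simp: Q_def length_le_lword le_imp_less_Suc)
  then obtain ds e e' where Q: "Q (ds, e, e')"
    and max: "\<And>E. Q E \<Longrightarrow> length (fst E) \<le> length ds" by (metis prod_cases3 fst_conv)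
  have sc: "score j ds e e' = lcs_len x y"
    using Q score_le_lcs[of j ds e e'] unfolding Q_def by auto
  \<comment> \<open>Matching a common letter at ones-offset at most 1 in a balanced segment costs at most one
    pair of majority letters, so it keeps the score but uses one more matched minority letter.\<close>
  have "admissible j e e'"
  proof (rule ccontr)
    assume "\<not> admissible j e e'"
    then obtain u1 c u2 v1 v2 where *: "e = u1 @ c # u2" "e' = v1 @ c # v2" "c \<noteq> j"
      "ones j u1 \<le> Suc (ones j v1)" "ones j v1 \<le> Suc (ones j u1)" "ones j e = ones j e'"
      by (auto simp: barren_def)
    hence "Q (ds @ [(u1, c, v1)], u2, v2)"
      using Q score_append[of j ds "[]"] by (auto simp: Q_def lword_append rword_append score_append)
    from max[OF this] show False by simp
  qed
  moreover have "admissible j u v" if d: "(u, c, v) \<in> set ds" for u c v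
  proof (rule ccontr)
    assume "\<not> admissible j u v"
    then obtain u1 b u2 v1 v2 where *: "u = u1 @ b # u2" "v = v1 @ b # v2" "b \<noteq> j"
      "ones j u1 \<le> Suc (ones j v1)" "ones j v1 \<le> Suc (ones j u1)" "ones j u = ones j v"
      by (auto simp: barren_def)
    obtain ds1 ds2 where ds: "ds = ds1 @ (u, c, v) # ds2"
      using d by (meson split_list)
    have "Q (ds1 @ (u1, b, v1) # (u2, c, v2) # ds2, e, e')"
      using Q * unfolding ds by (auto simp: Q_def lword_append rword_append score_append)
    from max[OF this] show False by (simp add: ds)
  qed
  ultimately show ?thesis using Q sc unfolding Q_def by fast
qed

section \<open>Imbalance of the segment pairs\<close>

definition gap :: "'a \<Rightarrow> 'a list \<Rightarrow> 'a list \<Rightarrow> nat" where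
  "gap j u v = (ones j u - ones j v) + (ones j v - ones j u)"

fun imbalance :: "'a \<Rightarrow> 'a seg list \<Rightarrow> 'a list \<Rightarrow> 'a list \<Rightarrow> nat" where
  "imbalance j [] e e' = gap j e e'"
| "imbalance j ((u, c, v) # ds) e e' = gap j u v + imbalance j ds e e'"

text \<open>For majority counts \<open>a\<close> and \<open>b\<close> of a segment pair, the
  absolute difference plus \<open>2 * min a b\<close> is \<open>a + b\<close>. Each cut adds
  \<open>2\<close> to both sides, and its letter, being a minority letter, does not enter the
  majority counts.\<close>

lemma imbalance_score:
  "matched_minor j ds \<Longrightarrow> imbalance j ds e e' + 2 * score j ds e e' =
     2 * length ds + ones j (lword ds e) + ones j (rword ds e')"
  by (induction j ds e e' rule: imbalance.induct) (auto simp: gap_def)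

lemma imbalance_le:
  assumes "matched_minor j ds" "score j ds e e' = lcs_len (lword ds e) (rword ds e')"
  shows "imbalance j ds e e' \<le> 2 * length ds + gap j (lword ds e) (rword ds e')"
proof -
  \<comment> \<open>The empty list of cuts is the trivial alignment, which matches majority letters
    only.\<close>
  have "min (ones j (lword ds e)) (ones j (rword ds e')) \<le> score j ds e e'"
    using score_le_lcs[of j "[]" "lword ds e" "rword ds e'"] assms(2) by simp
  thus ?thesis using imbalance_score[OF assms(1), of e e'] by (auto simp: gap_def)
qed

section \<open>Counting the replacements that gain or lose\<close>

lemma positions_card:
  "card {s \<in> positions j x y. R s} =
     card {i. i < length x \<and> x ! i \<noteq> j \<and> R (False, i)} +
     card {i. i < length y \<and> y ! i \<noteq> j \<and> R (True, i)}"
proof -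
  define A where "A = {i. i < length x \<and> x ! i \<noteq> j \<and> R (False, i)}"
  define B where "B = {i. i < length y \<and> y ! i \<noteq> j \<and> R (True, i)}"
  have fin: "finite A" "finite B" by (simp_all add: A_def B_def)
  have inj: "inj_on (Pair b) C" for b :: bool and C :: "nat set"
    by (rule inj_onI) simp
  have "s \<in> {s \<in> positions j x y. R s} \<longleftrightarrow> s \<in> Pair False ` A \<union> Pair True ` B" for s
    by (cases s; cases "fst s") (simp_all add: positions_def image_iff A_def B_def)
  hence "{s \<in> positions j x y. R s} = Pair False ` A \<union> Pair True ` B" by blast
  moreover have "card (Pair False ` A \<union> Pair True ` B) = card (Pair False ` A) + card (Pair True ` B)"
    using fin by (intro card_Un_disjoint finite_imageI) auto
  ultimately have "card {s \<in> positions j x y. R s} = card A + card B"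
    by (simp only: card_image[OF inj])
  thus ?thesis by (simp only: A_def B_def)
qed

lemma card_positions: "card (positions j x y) = minor j x + minor j y"
proof -
  have "card {i. i < length x \<and> x ! i \<noteq> j} = minor j x" for x
    by (simp only: minor_def length_filter_conv_card)
  moreover have "card (positions j x y) =
      card {i. i < length x \<and> x ! i \<noteq> j} + card {i. i < length y \<and> y ! i \<noteq> j}"
    using positions_card[of j x y "\<lambda>_. True"] unfolding simp_thms Collect_mem_eq .
  ultimately show ?thesis by simp
qed

lemma card_up_positions:
  assumes "score j ds e e' = lcs_len x y" "x = lword ds e" "y = rword ds e'"
  shows "deficit j ds e e' + deficit j (swap_segs ds) e' e \<le>
    card {s \<in> positions j x y.
      int (lcs_len (fst (perturb j x y s)) (snd (perturb j x y s))) - int (lcs_len x y) = 1}"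
proof -
  have comm: "lcs_len z x = lcs_len x z" for z by (rule lcs_len_commute)
  \<comment> \<open>A replacement that gains at all gains exactly one.\<close>
  have up: "int (lcs_len (z[i := j]) y) - int (lcs_len z y) = 1"
    if "i < length z" "Suc (lcs_len z y) \<le> lcs_len (z[i := j]) y" for z y i
  proof -
    have "lcs_len (z[i := j]) y \<le> Suc (lcs_len z y)"
      using lcs_len_substitute[of "take i z" j "drop (Suc i) z" y "z ! i"]
        id_take_nth_drop[OF that(1)] upd_conv_take_nth_drop[OF that(1), of j] by metis
    thus ?thesis using that(2) by simp
  qed
  have left: "deficit j ds e e' \<le> card {i. i < length (lword ds e) \<and> lword ds e ! i \<noteq> j \<and>
      int (lcs_len ((lword ds e)[i := j]) (rword ds e')) - int (lcs_len (lword ds e) (rword ds e')) = 1}"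
    if "score j ds e e' = lcs_len (lword ds e) (rword ds e')" for ds e e'
  proof -
    have "deficit j ds e e' \<le> card {i. i < length (lword ds e) \<and> lword ds e ! i \<noteq> j \<and>
       reaches j e' (rword ds e') (Suc (score j ds e e')) ((lword ds e)[i := j])}"
      using deficit_le_flips[of j ds e e'] by (simp add: flips_card)
    also have "\<dots> \<le> card {i. i < length (lword ds e) \<and> lword ds e ! i \<noteq> j \<and>
      int (lcs_len ((lword ds e)[i := j]) (rword ds e')) - int (lcs_len (lword ds e) (rword ds e')) = 1}"
      using that by (intro card_mono) (auto dest!: reaches_lcs intro!: up)
    finally show ?thesis .
  qed
  have "deficit j ds e e' \<le> card {i. i < length x \<and> x ! i \<noteq> j \<and>
      int (lcs_len (x[i := j]) y) - int (lcs_len x y) = 1}"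
    using left[of ds e e'] assms by simp
  \<comment> \<open>The bound for \<open>y\<close> is the one for \<open>x\<close> with the two
    words exchanged, the longest common subsequence being symmetric.\<close>
  moreover have "deficit j (swap_segs ds) e' e \<le> card {i. i < length y \<and> y ! i \<noteq> j \<and>
      int (lcs_len x (y[i := j])) - int (lcs_len x y) = 1}"
    using left[of "swap_segs ds" e' e] comm
    by (simp add: assms(1) assms(2,3)[symmetric])
  ultimately show ?thesis by (simp add: positions_card perturb_def)
qed

text \<open>Each cut has one matched letter in either word, hence the factor
  \<open>2\<close>.\<close>

lemma card_down_positions:
  assumes "score j ds e e' = lcs_len x y" "x = lword ds e" "y = rword ds e'"
  shows "card {s \<in> positions j x y.
      int (lcs_len (fst (perturb j x y s)) (snd (perturb j x y s))) - int (lcs_len x y) = -1}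
    \<le> 2 * length ds"
proof -
  have comm: "lcs_len z x = lcs_len x z" for z by (rule lcs_len_commute)
  have left: "card {i. i < length (lword ds e) \<and> lword ds e ! i \<noteq> j \<and>
      int (lcs_len ((lword ds e)[i := j]) (rword ds e')) - int (lcs_len (lword ds e) (rword ds e')) = -1}
      \<le> length ds"
    if "score j ds e e' = lcs_len (lword ds e) (rword ds e')" for ds e e'
  proof -
    have "card {i. i < length (lword ds e) \<and> lword ds e ! i \<noteq> j \<and>
      int (lcs_len ((lword ds e)[i := j]) (rword ds e')) - int (lcs_len (lword ds e) (rword ds e')) = -1} \<le>
      card {i. i < length (lword ds e) \<and> lword ds e ! i \<noteq> j \<and>
       \<not> reaches j e' (rword ds e') (score j ds e e') ((lword ds e)[i := j])}"
      using that by (intro card_mono) (auto dest!: reaches_lcs)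
    also have "\<dots> \<le> length ds"
      using flips_not_reaches[of j e' ds e] by (simp add: flips_card)
    finally show ?thesis .
  qed
  have "card {i. i < length x \<and> x ! i \<noteq> j \<and>
      int (lcs_len (x[i := j]) y) - int (lcs_len x y) = -1} \<le> length ds"
    using left[of ds e e'] assms by simp
  moreover have "card {i. i < length y \<and> y ! i \<noteq> j \<and>
      int (lcs_len x (y[i := j])) - int (lcs_len x y) = -1} \<le> length ds"
    using left[of "swap_segs ds" e' e] comm
    by (simp add: assms(1) assms(2,3)[symmetric])
  ultimately show ?thesis by (simp add: positions_card perturb_def)
qed

section \<open>Generating functions of words\<close>

text \<open>Polymorphic in the letters, since lists of segments are weighted in the same way as
  words.\<close>

definition wt :: "('a \<Rightarrow> real) \<Rightarrow> 'a list \<Rightarrow> real" where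
  "wt q u = prod_list (map q u)"

lemma wt_simps [simp]: "wt q [] = 1" "wt q (c # u) = q c * wt q u" "wt q (u @ v) = wt q u * wt q v"
  by (simp_all add: wt_def)

lemma wt_nonneg: "(\<And>c. c \<in> set u \<Longrightarrow> 0 \<le> q c) \<Longrightarrow> 0 \<le> wt q u"
  by (induction u) auto

lemma word_prob_eq_wt: "word_prob p x = wt p x"
  unfolding word_prob_def wt_def by (simp add: prod.list_conv_set_nth atLeast0LessThan)

lemma sum_wt_lists:
  assumes "finite A"
  shows "(\<Sum>xs | set xs \<subseteq> A \<and> length xs = n. wt g xs) = (sum g A) ^ n"
proof (induction n)
  case 0
  have "{xs. set xs \<subseteq> A \<and> length xs = 0} = {[]}" by auto
  thus ?case by simp
next
  case (Suc n)
  let ?Ls = "{xs. set xs \<subseteq> A \<and> length xs = n}"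
  have "(\<Sum>xs | set xs \<subseteq> A \<and> length xs = Suc n. wt g xs)
      = (\<Sum>xs\<in>(\<lambda>(a, xs). a # xs) ` (A \<times> ?Ls). wt g xs)"
    by (rule sum.cong) (auto simp: length_Suc_conv image_iff)
  also have "\<dots> = (\<Sum>(a, xs)\<in>A \<times> ?Ls. g a * wt g xs)"
    by (subst sum.reindex) (auto simp: inj_on_def case_prod_unfold)
  also have "\<dots> = sum g A * (\<Sum>xs\<in>?Ls. wt g xs)"
    by (simp add: sum_product sum.cartesian_product)
  finally show ?case using Suc by simp
qed

text \<open>Truncation keeps all generating functions finite sums, so no convergence has to be
  discussed; every segment of a word of length \<open>n\<close> is still included.\<close>

definition short_words :: "nat \<Rightarrow> nat \<Rightarrow> nat list set" where
  "short_words m n = {u. set u \<subseteq> {..<m} \<and> length u \<le> n}"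

lemma finite_short_words [simp]: "finite (short_words m n)"
  unfolding short_words_def by (rule finite_lists_length_le) simp

lemma sum_short_words_Suc:
  "(\<Sum>u\<in>short_words m (Suc n). F u) = F [] + (\<Sum>k<m. \<Sum>u\<in>short_words m n. F (k # u))"
proof -
  have eq: "short_words m (Suc n) = insert [] ((\<lambda>(k, u). k # u) ` ({..<m} \<times> short_words m n))"
  proof (rule set_eqI)
    fix u show "u \<in> short_words m (Suc n) \<longleftrightarrow>
        u \<in> insert [] ((\<lambda>(k, u). k # u) ` ({..<m} \<times> short_words m n))"
      by (cases u) (auto simp: short_words_def)
  qed
  show ?thesis
    unfolding eq
    by (subst sum.insert)
       (auto simp: sum.reindex inj_on_def sum.cartesian_product case_prod_unfold)
qed

definition ones_gf :: "nat \<Rightarrow> nat \<Rightarrow> (nat \<Rightarrow> real) \<Rightarrow> nat \<Rightarrow> nat \<Rightarrow> real" where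
  "ones_gf m j q n a = (\<Sum>u\<in>short_words m n. of_bool (ones j u = a) * wt q u)"

lemma wt_short_words_nonneg:
  "\<forall>k<m. 0 \<le> q k \<Longrightarrow> u \<in> short_words m n \<Longrightarrow> 0 \<le> wt q u"
  by (rule wt_nonneg) (auto simp: short_words_def)

lemma ones_gf_nonneg: "\<forall>k<m. 0 \<le> q k \<Longrightarrow> 0 \<le> ones_gf m j q n a"
  unfolding ones_gf_def by (intro sum_nonneg mult_nonneg_nonneg wt_short_words_nonneg) auto

text \<open>The right-hand side is the value without truncation: \<open>a\<close> majority letters
  of weight \<open>q j\<close> separate \<open>a + 1\<close> free stretches of minority letters,
  each of total weight \<open>1 / (1 - e)\<close>. The induction removes the first letter.\<close>

lemma ones_gf_le:
  assumes q: "\<forall>k<m. 0 \<le> q k" and j: "j < m" and e: "e = (\<Sum>k\<in>{..<m} - {j}. q k)" "e < 1"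
  shows "ones_gf m j q n a \<le> (q j / (1 - e)) ^ a / (1 - e)"
proof (induction n arbitrary: a)
  case 0
  have "short_words m 0 = {[]}" by (auto simp: short_words_def)
  moreover have "0 \<le> e" unfolding e(1) by (intro sum_nonneg) (use q in auto)
  ultimately show ?case using e q j by (auto simp: ones_gf_def)
next
  case (Suc n)
  have e0: "0 \<le> e" unfolding e(1) by (intro sum_nonneg) (use q in auto)
  let ?c = "q j / (1 - e)"
  have "ones_gf m j q (Suc n) a = of_bool (a = 0) +
      (\<Sum>k<m. \<Sum>u\<in>short_words m n. of_bool (ones j (k # u) = a) * wt q (k # u))"
    unfolding ones_gf_def by (subst sum_short_words_Suc) simp
  also have "(\<Sum>k<m. \<Sum>u\<in>short_words m n. of_bool (ones j (k # u) = a) * wt q (k # u)) =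
      (\<Sum>u\<in>short_words m n. of_bool (ones j (j # u) = a) * wt q (j # u)) +
      (\<Sum>k\<in>{..<m} - {j}. \<Sum>u\<in>short_words m n. of_bool (ones j (k # u) = a) * wt q (k # u))"
    using j by (subst sum.remove[of _ j]) auto
  also have "(\<Sum>u\<in>short_words m n. of_bool (ones j (j # u) = a) * wt q (j # u)) =
      (case a of 0 \<Rightarrow> 0 | Suc b \<Rightarrow> q j * ones_gf m j q n b)"
    by (cases a) (simp_all add: ones_gf_def sum_distrib_left mult.left_commute
        del: sum_of_bool_mult_eq)
  also have "(\<Sum>k\<in>{..<m} - {j}. \<Sum>u\<in>short_words m n. of_bool (ones j (k # u) = a) * wt q (k # u)) =
      e * ones_gf m j q n a"
    unfolding e(1) ones_gf_def sum_product
    by (intro sum.cong refl) auto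
  finally have eq: "ones_gf m j q (Suc n) a = of_bool (a = 0) +
     ((case a of 0 \<Rightarrow> 0 | Suc b \<Rightarrow> q j * ones_gf m j q n b) + e * ones_gf m j q n a)" .
  have le: "e * ones_gf m j q n a \<le> e * (?c ^ a / (1 - e))"
    using Suc.IH e0 by (rule mult_left_mono)
  show ?case
  proof (cases a)
    case 0
    have "1 + e * (1 / (1 - e)) = 1 / (1 - e)" using e(2) by (simp add: field_simps)
    thus ?thesis using eq le 0 by simp
  next
    case (Suc b)
    have "q j * ones_gf m j q n b \<le> q j * (?c ^ b / (1 - e))"
      using Suc.IH q j by (intro mult_left_mono) auto
    also have "\<dots> = ?c ^ a" using Suc by simp
    finally have "ones_gf m j q (Suc n) a \<le> ?c ^ a + e * (?c ^ a / (1 - e))"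
      using eq le Suc by simp
    also have "\<dots> = ?c ^ a / (1 - e)" using e(2) by (simp add: field_simps)
    finally show ?thesis .
  qed
qed

lemma geometric_sum_le:
  fixes x :: real
  assumes "0 \<le> x" "x < 1"
  shows "(\<Sum>i<n. x ^ i) \<le> 1 / (1 - x)"
  using assms by (simp add: sum_gp_strict divide_right_mono)

lemma sum_by_ones:
  "(\<Sum>u\<in>short_words m n. h (ones j u) * wt q u) = (\<Sum>a<Suc n. h a * ones_gf m j q n a)"
proof -
  have "(\<Sum>a<Suc n. h a * ones_gf m j q n a) =
      (\<Sum>u\<in>short_words m n. \<Sum>a<Suc n. of_bool (ones j u = a) * (h a * wt q u))"
    unfolding ones_gf_def sum_distrib_left
    by (subst sum.swap) (intro sum.cong refl, auto)
  also have "\<dots> = (\<Sum>u\<in>short_words m n. h (ones j u) * wt q u)"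
  proof (intro sum.cong refl)
    fix u assume u: "u \<in> short_words m n"
    hence "ones j u < Suc n" using ones_add_minor[of u j] by (auto simp: short_words_def)
    thus "(\<Sum>a<Suc n. of_bool (ones j u = a) * (h a * wt q u)) = h (ones j u) * wt q u"
      by (subst sum.remove[of _ "ones j u"]) auto
  qed
  finally show ?thesis by simp
qed

text \<open>The word with fewer majority letters carries its own weight \<open>q'\<close>, because
  its minority letters, whose replacement gains, are damped later on.\<close>

definition ordered_sum :: "nat \<Rightarrow> nat \<Rightarrow> real \<Rightarrow> (nat \<Rightarrow> real) \<Rightarrow> (nat \<Rightarrow> real) \<Rightarrow> nat \<Rightarrow> real" where
  "ordered_sum m j w q' q n = (\<Sum>u\<in>short_words m n. \<Sum>v\<in>short_words m n.
     of_bool (ones j u \<le> ones j v) * w ^ (ones j v - ones j u) * wt q' u * wt q v)"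

text \<open>After grouping by majority counts \<open>a\<close> and \<open>b = a + i\<close>, the
  double sum is dominated by a geometric series in \<open>t' * t\<close> for \<open>a\<close> and
  one in \<open>w * t\<close> for \<open>i\<close>.\<close>

lemma ordered_sum_le:
  assumes q: "\<forall>k<m. 0 \<le> q k" "\<forall>k<m. 0 \<le> q' k" and j: "j < m" and w: "0 \<le> w"
    and e: "e = (\<Sum>k\<in>{..<m} - {j}. q k)" "e < 1" "e' = (\<Sum>k\<in>{..<m} - {j}. q' k)" "e' < 1"
    and t: "t = q j / (1 - e)" "t' = q' j / (1 - e')" "t' * t < 1" "w * t < 1"
  shows "ordered_sum m j w q' q n \<le> 1 / ((1 - e') * (1 - e) * (1 - t' * t) * (1 - w * t))"
proof -
  have t0: "0 \<le> t" "0 \<le> t'" using t e q j by auto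
  define f where "f a b = of_bool (a \<le> b) * w ^ (b - a)" for a b :: nat
  have f0: "0 \<le> f a b" for a b using w by (simp add: f_def)
  have "ordered_sum m j w q' q n =
     (\<Sum>u\<in>short_words m n. (\<Sum>v\<in>short_words m n. f (ones j u) (ones j v) * wt q v) * wt q' u)"
    unfolding ordered_sum_def f_def sum_distrib_right
    by (intro sum.cong refl) auto
  also have "\<dots> = (\<Sum>u\<in>short_words m n. (\<Sum>b<Suc n. f (ones j u) b * ones_gf m j q n b) * wt q' u)"
    by (subst sum_by_ones) simp
  also have "\<dots> = (\<Sum>a<Suc n. (\<Sum>b<Suc n. f a b * ones_gf m j q n b) * ones_gf m j q' n a)"
    by (rule sum_by_ones)
  also have "\<dots> \<le> (\<Sum>a<Suc n. (\<Sum>b<Suc n. f a b * (t ^ b / (1 - e))) * (t' ^ a / (1 - e')))"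
    unfolding t using ones_gf_le[OF q(1) j e(1,2)] ones_gf_le[OF q(2) j e(3,4)] q e j
    by (intro sum_mono mult_mono mult_left_mono f0 sum_nonneg mult_nonneg_nonneg ones_gf_nonneg) auto
  also have "\<dots> = (\<Sum>a<Suc n. (\<Sum>b<Suc n. f a b * t ^ b) * t' ^ a) * (1 / ((1 - e') * (1 - e)))"
    unfolding sum_distrib_right[of _ _ "1 / ((1 - e') * (1 - e))"]
    by (intro sum.cong refl) (simp add: sum_divide_distrib[symmetric] del: sum.lessThan_Suc)
  also have "\<dots> \<le> (1 / ((1 - t' * t) * (1 - w * t))) * (1 / ((1 - e') * (1 - e)))"
  proof (rule mult_right_mono)
    have inner: "(\<Sum>b<Suc n. f a b * t ^ b) \<le> t ^ a * (1 / (1 - w * t))" if "a < Suc n" for a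
    proof -
      have "(\<Sum>b<Suc n. f a b * t ^ b) = (\<Sum>b\<in>{a..<Suc n}. f a b * t ^ b)"
        by (rule sum.mono_neutral_right) (auto simp: f_def)
      also have "\<dots> = (\<Sum>i\<in>{..<Suc n - a}. t ^ a * (w * t) ^ i)"
        using that by (intro sum.reindex_bij_witness[of _ "\<lambda>i. i + a" "\<lambda>b. b - a"])
          (auto simp: f_def power_mult_distrib power_add[symmetric])
      also have "\<dots> \<le> t ^ a * (1 / (1 - w * t))"
        using geometric_sum_le[of "w * t" "Suc n - a"] w t0 t(4)
        by (simp only: sum_distrib_left[symmetric]) (intro mult_left_mono, auto)
      finally show ?thesis .
    qed
    have "(\<Sum>a<Suc n. (\<Sum>b<Suc n. f a b * t ^ b) * t' ^ a) \<le>
        (\<Sum>a<Suc n. (t ^ a * (1 / (1 - w * t))) * t' ^ a)"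
      using inner t0 by (intro sum_mono mult_right_mono) auto
    also have "\<dots> = (\<Sum>a<Suc n. (t' * t) ^ a) * (1 / (1 - w * t))"
      unfolding sum_distrib_right by (intro sum.cong refl) (simp add: power_mult_distrib)
    also have "\<dots> \<le> (1 / (1 - t' * t)) * (1 / (1 - w * t))"
      using geometric_sum_le[OF mult_nonneg_nonneg[OF t0(2,1)] t(3), of "Suc n"] t(4)
      by (intro mult_right_mono) (simp_all del: sum.lessThan_Suc)
    finally show "(\<Sum>a<Suc n. (\<Sum>b<Suc n. f a b * t ^ b) * t' ^ a)
        \<le> 1 / ((1 - t' * t) * (1 - w * t))" by simp
  qed (use e in auto)
  finally show ?thesis by (simp add: mult_ac)
qed

section \<open>Balanced pairs without close common minority letters\<close>

lemma split_after_ones: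
  "k < ones j u \<Longrightarrow> \<exists>b u'. u = b @ j # u' \<and> ones j b = k"
proof (induction u arbitrary: k)
  case (Cons c u)
  show ?case
  proof (cases "c = j \<and> k = 0")
    case True
    thus ?thesis by (intro exI[of _ "[]"] exI[of _ u]) auto
  next
    case False
    define k' where "k' = (if c = j then k - 1 else k)"
    have "k' < ones j u" using Cons.prems False by (auto simp: k'_def)
    then obtain b u' where "u = b @ j # u'" "ones j b = k'" using Cons.IH by blast
    thus ?thesis using False
      by (intro exI[of _ "c # b"] exI[of _ u']) (auto simp: k'_def)
  qed
qed auto

text \<open>Removing prefixes with equally many majority letters leaves all majority-offsets
  unchanged.\<close>

lemma barren_drop_block:
  assumes "barren j (b @ u) (d @ v)" "ones j b = ones j d"
  shows "barren j u v"
  unfolding barren_def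
proof (rule notI, elim exE conjE)
  fix u1 c u2 v1 v2
  assume *: "u = u1 @ c # u2" "v = v1 @ c # v2" "c \<noteq> j"
    "ones j u1 \<le> Suc (ones j v1)" "ones j v1 \<le> Suc (ones j u1)"
  have "b @ u = (b @ u1) @ c # u2" "d @ v = (d @ v1) @ c # v2"
    "ones j (b @ u1) \<le> Suc (ones j (d @ v1))" "ones j (d @ v1) \<le> Suc (ones j (b @ u1))"
    using * assms(2) by auto
  thus False using assms(1) \<open>c \<noteq> j\<close> unfolding barren_def by blast
qed

text \<open>When both blocks have at most one majority letter, any two of their positions have
  majority-offset at most \<open>1\<close>.\<close>

lemma barren_block_disjoint:
  assumes "barren j (b @ u) (d @ v)" "ones j b \<le> 1" "ones j d \<le> 1"
  shows "set b \<inter> set d \<subseteq> {j}"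
proof
  fix c assume c: "c \<in> set b \<inter> set d"
  obtain b1 b2 d1 d2 where bd: "b = b1 @ c # b2" "d = d1 @ c # d2"
    using c by (auto dest!: split_list)
  have "b @ u = b1 @ c # (b2 @ u)" "d @ v = d1 @ c # (d2 @ v)"
    "ones j b1 \<le> Suc (ones j d1)" "ones j d1 \<le> Suc (ones j b1)"
    using bd assms(2,3) by auto
  thus "c \<in> {j}" using assms(1) unfolding barren_def by blast
qed

definition barren_sum :: "nat \<Rightarrow> nat \<Rightarrow> (nat \<Rightarrow> real) \<Rightarrow> nat \<Rightarrow> real" where
  "barren_sum m j q n = (\<Sum>(u, v) | u \<in> short_words m n \<and> v \<in> short_words m n \<and>
     ones j u = ones j v \<and> barren j u v. wt q u * wt q v)"

definition block_sum :: "nat \<Rightarrow> nat \<Rightarrow> (nat \<Rightarrow> real) \<Rightarrow> nat \<Rightarrow> real" where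
  "block_sum m j q n = (\<Sum>(b, d) | b \<in> short_words m n \<and> d \<in> short_words m n \<and>
     ones j b = 1 \<and> ones j d = 1 \<and> set b \<inter> set d \<subseteq> {j}. wt q b * wt q d)"

lemma sum_equal_ones:
  "(\<Sum>(u, v) | u \<in> short_words m n \<and> v \<in> short_words m n \<and> ones j u = a \<and> ones j v = a.
      wt q u * wt q v) = ones_gf m j q n a ^ 2"
proof -
  have "ones_gf m j q n a = (\<Sum>u | u \<in> short_words m n \<and> ones j u = a. wt q u)"
    unfolding ones_gf_def
    by (subst sum.inter_filter, simp, intro sum.cong refl) (simp add: of_bool_def)
  moreover have "{(u, v). u \<in> short_words m n \<and> v \<in> short_words m n \<and> ones j u = a \<and> ones j v = a}
      = {u \<in> short_words m n. ones j u = a} \<times> {u \<in> short_words m n. ones j u = a}" by auto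
  ultimately show ?thesis by (simp add: power2_eq_square sum_product sum.cartesian_product)
qed

lemma finite_short_pairs: "finite {(u, v). u \<in> short_words m n \<and> v \<in> short_words m n \<and> P u v}"
  by (rule finite_subset[of _ "short_words m n \<times> short_words m n"]) auto

text \<open>Cutting after every second majority letter makes offsets up to \<open>1\<close> a property of independent
  blocks.\<close>

lemma barren_sum_le:
  assumes q: "\<forall>k<m. 0 \<le> q k"
  shows "barren_sum m j q n \<le> ones_gf m j q n 0 ^ 2 + ones_gf m j q n 1 ^ 2 +
     (q j)\<^sup>2 * block_sum m j q n * barren_sum m j q n"
proof -
  let ?W = "short_words m n"
  define E where "E = (\<lambda>a. {(u, v). u \<in> ?W \<and> v \<in> ?W \<and> ones j u = a \<and> ones j v = a})"
  define Z where "Z = {(u, v). u \<in> ?W \<and> v \<in> ?W \<and> ones j u = ones j v \<and> barren j u v}"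
  define M where "M = {(u, v). u \<in> ?W \<and> v \<in> ?W \<and> ones j u = ones j v \<and> barren j u v \<and> 1 < ones j u}"
  define D where "D = {(b, d). b \<in> ?W \<and> d \<in> ?W \<and> ones j b = 1 \<and> ones j d = 1 \<and> set b \<inter> set d \<subseteq> {j}}"
  have fin: "finite (E a)" "finite Z" "finite M" "finite D" for a
    unfolding E_def Z_def M_def D_def by (rule finite_short_pairs)+
  let ?g = "\<lambda>(u, v). wt q u * wt q v"
  have nn: "0 \<le> ?g x" if "x \<in> ?W \<times> ?W" for x
    using that by (auto intro!: mult_nonneg_nonneg wt_short_words_nonneg[OF q])
  have sub: "E a \<subseteq> ?W \<times> ?W" "M \<subseteq> ?W \<times> ?W" "Z \<subseteq> ?W \<times> ?W" "D \<subseteq> ?W \<times> ?W" for a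
    by (auto simp: E_def M_def Z_def D_def)
  have "barren_sum m j q n = sum ?g Z" by (simp add: barren_sum_def Z_def)
  also have "\<dots> \<le> sum ?g (E 0 \<union> E 1 \<union> M)"
  proof (rule sum_mono2)
    show "Z \<subseteq> E 0 \<union> E 1 \<union> M" by (force simp: Z_def E_def M_def)
    show "0 \<le> ?g b" if "b \<in> E 0 \<union> E 1 \<union> M - Z" for b
      using that sub by (intro nn) blast
  qed (simp add: fin)
  also have "\<dots> \<le> sum ?g (E 0) + sum ?g (E 1) + sum ?g M"
  proof -
    have "sum ?g (E 0 \<union> E 1 \<union> M) = sum ?g (E 0 \<union> E 1) + sum ?g M"
      by (rule sum.union_disjoint) (auto simp: fin, auto simp: E_def M_def)
    also have "sum ?g (E 0 \<union> E 1) = sum ?g (E 0) + sum ?g (E 1)"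
      by (rule sum.union_disjoint) (auto simp: fin, auto simp: E_def)
    finally show ?thesis by simp
  qed
  also have "sum ?g M \<le> (\<Sum>x\<in>D \<times> Z. (q j)\<^sup>2 * (?g (fst x) * ?g (snd x)))"
  proof (rule sum_le_included[where i = "\<lambda>((b, d), (u, v)). (b @ j # u, d @ j # v)"])
    show "\<forall>x\<in>D \<times> Z. 0 \<le> (q j)\<^sup>2 * (?g (fst x) * ?g (snd x))"
      using sub by (auto intro!: mult_nonneg_nonneg wt_short_words_nonneg[OF q])
    show "\<forall>x\<in>M. \<exists>y\<in>D \<times> Z. (\<lambda>((b, d), (u, v)). (b @ j # u, d @ j # v)) y = x \<and>
        ?g x \<le> (q j)\<^sup>2 * (?g (fst y) * ?g (snd y))"
    proof
      fix x assume "x \<in> M"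
      then obtain u v where x: "x = (u, v)" "u \<in> ?W" "v \<in> ?W" "ones j u = ones j v" "barren j u v"
        "1 < ones j u" by (auto simp: M_def)
      \<comment> \<open>The block \<open>b\<close> keeps the first majority letter and the
        separating \<open>j\<close> is the second one. The separators of the two words give the
        factor \<open>(q j)\<^sup>2\<close>.\<close>
      obtain b u' where b: "u = b @ j # u'" "ones j b = 1" using split_after_ones x(6) by metis
      obtain d v' where d: "v = d @ j # v'" "ones j d = 1" using split_after_ones x(4,6) by metis
      have "set b \<inter> set d \<subseteq> {j}"
        using barren_block_disjoint[of j b "j # u'" d "j # v'"] b d x(5) by simp
      moreover have "barren j u' v'"
        using barren_drop_block[of j "b @ [j]" u' "d @ [j]" v'] b d x(5) by simp
      moreover have "b \<in> ?W" "d \<in> ?W" "u' \<in> ?W" "v' \<in> ?W"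
        using x(2,3) b d by (auto simp: short_words_def)
      moreover have "ones j u' = ones j v'" using x(4) b d by simp
      ultimately have mem: "((b, d), (u', v')) \<in> D \<times> Z" using b d by (auto simp: D_def Z_def)
      have eq: "?g x = (q j)\<^sup>2 * (?g (b, d) * ?g (u', v'))"
        using x b d by (simp add: power2_eq_square)
      have "(\<lambda>((b, d), (u, v)). (b @ j # u, d @ j # v)) ((b, d), (u', v')) = x"
        using x b d by simp
      thus "\<exists>y\<in>D \<times> Z. (\<lambda>((b, d), (u, v)). (b @ j # u, d @ j # v)) y = x \<and>
        ?g x \<le> (q j)\<^sup>2 * (?g (fst y) * ?g (snd y))"
        using eq by (intro bexI[OF _ mem] conjI) auto
    qed
  qed (use fin in auto)
  also have "(\<Sum>x\<in>D \<times> Z. (q j)\<^sup>2 * (?g (fst x) * ?g (snd x))) = (q j)\<^sup>2 * (sum ?g D * sum ?g Z)"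
  proof -
    have "sum ?g D * sum ?g Z = (\<Sum>x\<in>D \<times> Z. ?g (fst x) * ?g (snd x))"
      unfolding sum_product by (subst sum.cartesian_product) (auto intro!: sum.cong)
    thus ?thesis by (simp only: sum_distrib_left)
  qed
  finally show ?thesis
    by (simp add: sum_equal_ones E_def D_def Z_def barren_sum_def block_sum_def mult.assoc)
qed

text \<open>The \<open>4\<close> counts the blocks consisting of one majority and one copy of the same minority letter,
  in either order: each occurs among all pairs of blocks but not among the disjoint ones.\<close>

lemma block_sum_le:
  assumes q: "\<forall>k<m. 0 \<le> q k" and n: "2 \<le> n" and j: "j < m"
  shows "block_sum m j q n + 4 * (q j)\<^sup>2 * (\<Sum>k\<in>{..<m} - {j}. (q k)\<^sup>2) \<le> ones_gf m j q n 1 ^ 2"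
proof -
  let ?W = "short_words m n"
  let ?g = "\<lambda>(u, v). wt q u * wt q v"
  define D where "D = {(b, d). b \<in> ?W \<and> d \<in> ?W \<and> ones j b = 1 \<and> ones j d = 1 \<and> set b \<inter> set d \<subseteq> {j}}"
  define E where "E = {(b, d). b \<in> ?W \<and> d \<in> ?W \<and> ones j b = 1 \<and> ones j d = 1}"
  \<comment> \<open>The flag \<open>s\<close> chooses the order of the two letters. Such blocks have
    length \<open>2\<close>, which is where \<open>2 \<le> n\<close> enters.\<close>
  define h where "h = (\<lambda>s k. if s then [k, j] else [j, k])"
  define I where "I = ({..<m} - {j}) \<times> (UNIV :: bool set) \<times> (UNIV :: bool set)"
  define \<phi> where "\<phi> = (\<lambda>(k, s, s'). (h s k, h s' k))"
  have inj: "inj_on \<phi> I"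
    by (auto simp: inj_on_def I_def \<phi>_def h_def split: if_splits)
  have sub: "\<phi> ` I \<subseteq> E"
    using n j by (auto simp: I_def \<phi>_def E_def h_def short_words_def split: if_splits)
  have disj: "D \<inter> \<phi> ` I = {}"
    by (auto simp: I_def \<phi>_def D_def h_def split: if_splits)
  have fin: "finite D" "finite E" unfolding D_def E_def by (rule finite_short_pairs)+
  have finI: "finite I" by (simp add: I_def)
  have "sum ?g (\<phi> ` I) = (\<Sum>x\<in>I. (q j)\<^sup>2 * (q (fst x))\<^sup>2)"
    by (subst sum.reindex[OF inj]) (auto simp: \<phi>_def h_def power2_eq_square intro!: sum.cong)
  also have "\<dots> = (\<Sum>k\<in>{..<m} - {j}. \<Sum>s\<in>(UNIV :: (bool \<times> bool) set). (q j)\<^sup>2 * (q k)\<^sup>2)"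
    unfolding I_def by (subst sum.cartesian_product) (auto simp: case_prod_unfold)
  also have "\<dots> = 4 * (q j)\<^sup>2 * (\<Sum>k\<in>{..<m} - {j}. (q k)\<^sup>2)"
    by (simp add: sum_distrib_left card_cartesian_product mult.assoc
        UNIV_Times_UNIV[symmetric] del: UNIV_Times_UNIV)
  finally have "sum ?g D + 4 * (q j)\<^sup>2 * (\<Sum>k\<in>{..<m} - {j}. (q k)\<^sup>2) = sum ?g (D \<union> \<phi> ` I)"
    using fin finI disj by (subst sum.union_disjoint) auto
  also have "\<dots> \<le> sum ?g E"
  proof (rule sum_mono2)
    show "D \<union> \<phi> ` I \<subseteq> E" using sub by (auto simp: D_def E_def)
    show "0 \<le> ?g b" if "b \<in> E - (D \<union> \<phi> ` I)" for b
      using that q by (auto simp: E_def intro!: mult_nonneg_nonneg wt_short_words_nonneg[OF q])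
  qed (rule fin)
  finally show ?thesis by (simp add: D_def E_def block_sum_def sum_equal_ones)
qed

section \<open>Union bound over decompositions\<close>

fun segprod :: "('a list \<Rightarrow> 'a list \<Rightarrow> real) \<Rightarrow> 'a seg list \<Rightarrow> 'a list \<Rightarrow> 'a list \<Rightarrow> real" where
  "segprod \<theta> [] e e' = \<theta> e e'"
| "segprod \<theta> ((u, c, v) # ds) e e' = \<theta> u v * segprod \<theta> ds e e'"

lemma lword_memD: "(u, c, v) \<in> set ds \<Longrightarrow> insert c (set u) \<subseteq> set (lword ds e) \<and> length u \<le> length (lword ds e)"
  by (induction ds e rule: lword.induct) auto

lemma rword_memD: "(u, c, v) \<in> set ds \<Longrightarrow> insert c (set v) \<subseteq> set (rword ds e) \<and> length v \<le> length (rword ds e)"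
  by (induction ds e rule: rword.induct) auto

lemma set_lword_end: "set e \<subseteq> set (lword ds e) \<and> length e \<le> length (lword ds e)"
  by (induction ds e rule: lword.induct) auto

lemma set_rword_end: "set e \<subseteq> set (rword ds e) \<and> length e \<le> length (rword ds e)"
  by (induction ds e rule: rword.induct) auto

text \<open>A cut letter occurs in both words, hence \<open>(q c)\<^sup>2\<close>. The weight
  becomes a product over the entries of \<open>ds\<close>, so that summing over all
  \<open>ds\<close> is summing over words in the alphabet of segments.\<close>

lemma segprod_wt:
  "z ^ length ds * segprod \<theta> ds e e' * wt q (lword ds e) * wt q (rword ds e') =
     wt (\<lambda>(u, c, v). z * (q c)\<^sup>2 * (\<theta> u v * wt q u * wt q v)) ds * (\<theta> e e' * wt q e * wt q e')"
  by (induction \<theta> ds e e' rule: segprod.induct) (simp_all add: power2_eq_square mult_ac)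

lemma wt_scale: "wt (\<lambda>k. s * p k) x = s ^ length x * wt p x"
  by (induction x) (simp_all add: mult_ac)

lemma sum_wt_short_lists_le:
  assumes "finite A" "\<forall>a\<in>A. 0 \<le> g a" "sum g A \<le> S" "S < 1"
  shows "(\<Sum>xs | set xs \<subseteq> A \<and> length xs \<le> n. wt g xs) \<le> 1 / (1 - S)"
proof -
  have "{xs. set xs \<subseteq> A \<and> length xs \<le> n} = (\<Union>k\<in>{..<Suc n}. {xs. set xs \<subseteq> A \<and> length xs = k})"
    by auto
  hence "(\<Sum>xs | set xs \<subseteq> A \<and> length xs \<le> n. wt g xs) =
      (\<Sum>k<Suc n. \<Sum>xs | set xs \<subseteq> A \<and> length xs = k. wt g xs)"
    using assms(1) by (simp only:) (subst sum.UNION_disjoint, auto intro: finite_lists_length_eq)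
  also have "\<dots> = (\<Sum>k<Suc n. sum g A ^ k)"
    using sum_wt_lists[OF assms(1), of g] by simp
  also have "\<dots> \<le> 1 / (1 - sum g A)"
    using assms by (intro geometric_sum_le sum_nonneg) auto
  also have "\<dots> \<le> 1 / (1 - S)"
    using assms by (intro divide_left_mono) auto
  finally show ?thesis .
qed

lemma finite_words: "finite (words m n)"
  unfolding words_def by (rule finite_subset[OF _ finite_lists_length_eq[of "{..<m}" n]]) auto

text \<open>The geometric weight \<open>s\<close> per letter is a generating function variable: it frees the segment
  lengths from the constraint that they sum to \<open>n\<close>, so that the segments can be summed independently.\<close>

lemma decomposition_union_bound:
  fixes p :: "nat \<Rightarrow> real"
  assumes p: "\<forall>k<m. 0 \<le> p k" and bad: "bad \<subseteq> words m n \<times> words m n"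
    and \<theta>: "\<And>u v. 0 \<le> \<theta> u v" and pos: "0 \<le> C" "0 \<le> z" "0 < s"
    and T: "(\<Sum>u\<in>short_words m n. \<Sum>v\<in>short_words m n.
              \<theta> u v * wt (\<lambda>k. s * p k) u * wt (\<lambda>k. s * p k) v) \<le> T"
    and S: "z * s\<^sup>2 * (\<Sum>k\<in>{..<m} - {j}. (p k)\<^sup>2) * T \<le> S" "S < 1"
    and wit: "\<And>x y. (x, y) \<in> bad \<Longrightarrow> \<exists>ds e e'. x = lword ds e \<and> y = rword ds e' \<and>
        matched_minor j ds \<and> 1 \<le> C * (z ^ length ds * segprod \<theta> ds e e')"
  shows "pair_prob p bad \<le> C * (1 / s) ^ (2 * n) * (T / (1 - S))"
proof -
  define q where "q = (\<lambda>k. s * p k)"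
  have q0: "\<forall>k<m. 0 \<le> q k" using p pos by (auto simp: q_def)
  let ?W = "short_words m n"
  define A where "A = ?W \<times> ({..<m} - {j}) \<times> ?W"
  define g where "g = (\<lambda>(u, c, v). z * (q c)\<^sup>2 * (\<theta> u v * wt q u * wt q v))"
  define h where "h = (\<lambda>(e, e'). \<theta> e e' * wt q e * wt q e')"
  define I where "I = {ds. set ds \<subseteq> A \<and> length ds \<le> n} \<times> (?W \<times> ?W)"
  define G where "G = (\<lambda>(ds, ee). C * (1 / s) ^ (2 * n) * (wt g ds * h ee))"
  have wtq: "0 \<le> wt q u" if "u \<in> ?W" for u using wt_short_words_nonneg[OF q0 that] .
  have g0: "\<forall>a\<in>A. 0 \<le> g a"
    using pos \<theta> by (auto simp: A_def g_def intro!: mult_nonneg_nonneg wtq)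
  have h0: "0 \<le> h ee" if "ee \<in> ?W \<times> ?W" for ee
    using that \<theta> by (auto simp: h_def intro!: mult_nonneg_nonneg wtq)
  have finA: "finite A" by (simp add: A_def)
  have finI: "finite I" unfolding I_def using finA by (intro finite_cartesian_product finite_lists_length_le) auto
  have hsum: "sum h (?W \<times> ?W) \<le> T"
    using T by (simp add: h_def sum.cartesian_product q_def)
  have h_nonneg: "0 \<le> sum h (?W \<times> ?W)" using h0 by (intro sum_nonneg)
  have "sum g A = (\<Sum>u\<in>?W. \<Sum>c\<in>{..<m} - {j}. \<Sum>v\<in>?W. z * (q c)\<^sup>2 * (\<theta> u v * wt q u * wt q v))"
    by (simp add: A_def g_def sum.cartesian_product)
  also have "\<dots> = (\<Sum>c\<in>{..<m} - {j}. \<Sum>u\<in>?W. \<Sum>v\<in>?W. z * (q c)\<^sup>2 * (\<theta> u v * wt q u * wt q v))"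
    by (rule sum.swap)
  also have "\<dots> = (\<Sum>c\<in>{..<m} - {j}. z * (q c)\<^sup>2 * sum h (?W \<times> ?W))"
    by (simp add: h_def sum.cartesian_product[symmetric] sum_distrib_left)
  also have "\<dots> = z * s\<^sup>2 * (\<Sum>k\<in>{..<m} - {j}. (p k)\<^sup>2) * sum h (?W \<times> ?W)"
    by (simp add: q_def sum_distrib_left sum_distrib_right power_mult_distrib mult_ac)
  also have "\<dots> \<le> z * s\<^sup>2 * (\<Sum>k\<in>{..<m} - {j}. (p k)\<^sup>2) * T"
    using hsum pos by (intro mult_left_mono mult_nonneg_nonneg sum_nonneg) auto
  finally have gS: "sum g A \<le> S" using S by linarith
  have "pair_prob p bad = (\<Sum>(x, y)\<in>bad. wt p x * wt p y)"
    by (simp add: pair_prob_def word_prob_eq_wt)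
  also have "\<dots> \<le> sum G I"
  \<comment> \<open>Each bad pair is charged to the decomposition provided by \<open>wit\<close>,
    whose weight under \<open>G\<close> is at least the probability of the pair.\<close>
  proof (rule sum_le_included[where i = "\<lambda>(ds, e, e'). (lword ds e, rword ds e')"])
    show "finite bad" using bad finite_words by (meson finite_SigmaI finite_subset)
    show "\<forall>x\<in>I. 0 \<le> G x"
    proof
      fix x assume "x \<in> I"
      then obtain ds ee where x: "x = (ds, ee)" "set ds \<subseteq> A" "ee \<in> ?W \<times> ?W" by (auto simp: I_def)
      have "0 \<le> wt g ds" using x g0 by (intro wt_nonneg) auto
      thus "0 \<le> G x" using x h0 pos by (auto simp: G_def intro!: mult_nonneg_nonneg)
    qed
    show "\<forall>x\<in>bad. \<exists>y\<in>I. (\<lambda>(ds, e, e'). (lword ds e, rword ds e')) y = x \<and>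
        (\<lambda>(x, y). wt p x * wt p y) x \<le> G y"
    proof
      fix xy assume xy: "xy \<in> bad"
      obtain x y where xy_eq: "xy = (x, y)" by (cases xy)
      obtain ds e e' where d: "x = lword ds e" "y = rword ds e'" "matched_minor j ds"
        "1 \<le> C * (z ^ length ds * segprod \<theta> ds e e')"
        using wit xy xy_eq by blast
      have xy': "x \<in> words m n" "y \<in> words m n" using xy xy_eq bad by auto
      have "e \<in> ?W" "e' \<in> ?W"
        using set_lword_end[of e ds] set_rword_end[of e' ds] xy' d
        by (auto simp: short_words_def words_def)
      moreover have "set ds \<subseteq> A"
      proof
        fix t assume t: "t \<in> set ds"
        obtain u c v where t_eq: "t = (u, c, v)" by (cases t)
        show "t \<in> A"
          using lword_memD[of u c v ds e] rword_memD[of u c v ds e'] t xy' d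
          by (auto simp: t_eq A_def short_words_def words_def)
      qed
      moreover have "length ds \<le> n" using length_le_lword[of ds e] xy' d by (simp add: words_def)
      ultimately have mem: "(ds, e, e') \<in> I" by (simp add: I_def)
      have px: "0 \<le> wt p x * wt p y"
        using xy' p by (intro mult_nonneg_nonneg wt_nonneg) (auto simp: words_def)
      have len: "length x = n" "length y = n" using xy' by (auto simp: words_def)
      \<comment> \<open>Both words have length \<open>n\<close>, so passing from \<open>p\<close> to
        \<open>q\<close> contributes \<open>s ^ (2 * n)\<close>, which the prefactor
        cancels.\<close>
      have "G (ds, e, e') = C * (1 / s) ^ (2 * n) * (z ^ length ds * segprod \<theta> ds e e' * wt q x * wt q y)"
        using segprod_wt[of z ds \<theta> e e' q] d by (simp add: G_def g_def h_def)
      also have "\<dots> = (C * (z ^ length ds * segprod \<theta> ds e e')) * (wt p x * wt p y)"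
        unfolding q_def wt_scale len
        using pos by (simp add: power_mult power2_eq_square power_mult_distrib field_simps)
      finally have "wt p x * wt p y \<le> G (ds, e, e')"
        using mult_right_mono[OF d(4) px] by simp
      thus "\<exists>y\<in>I. (\<lambda>(ds, e, e'). (lword ds e, rword ds e')) y = xy \<and>
        (\<lambda>(x, y). wt p x * wt p y) xy \<le> G y"
        using d xy_eq by (intro bexI[OF _ mem]) auto
    qed
  qed (rule finI)
  also have "sum G I = C * (1 / s) ^ (2 * n) *
      ((\<Sum>ds | set ds \<subseteq> A \<and> length ds \<le> n. wt g ds) * sum h (?W \<times> ?W))"
    unfolding I_def G_def
    by (subst sum_product, subst sum.cartesian_product, subst sum_distrib_left)
       (simp add: case_prod_unfold)
  also have "\<dots> \<le> C * (1 / s) ^ (2 * n) * ((1 / (1 - S)) * T)"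
  proof (intro mult_left_mono mult_mono)
    show "(\<Sum>ds | set ds \<subseteq> A \<and> length ds \<le> n. wt g ds) \<le> 1 / (1 - S)"
      by (rule sum_wt_short_lists_le[OF finA g0 gS S(2)])
  qed (use hsum h_nonneg pos S in auto)
  finally show ?thesis by simp
qed

text \<open>Exponential Markov inequality: on \<open>bad\<close> the function in \<open>wit\<close>
  is at least \<open>1\<close>, and its expectation factorizes over the letters.\<close>

lemma minor_markov:
  fixes p :: "nat \<Rightarrow> real"
  assumes p: "\<forall>k<m. 0 \<le> p k" and j: "j < m" and bad: "bad \<subseteq> words m n \<times> words m n"
    and t: "0 \<le> t" "0 \<le> t'" and C: "0 \<le> C"
    and wit: "\<And>x y. (x, y) \<in> bad \<Longrightarrow> 1 \<le> C * (t ^ minor j x * t' ^ minor j y)"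
  shows "pair_prob p bad \<le> C * ((p j + t * (\<Sum>k\<in>{..<m} - {j}. p k)) * (p j + t' * (\<Sum>k\<in>{..<m} - {j}. p k))) ^ n"
proof -
  define f where "f = (\<lambda>t k. if k = j then p k else t * p k)"
  have wf: "wt (f t) x = wt p x * t ^ minor j x" for t x
    by (induction x) (auto simp: f_def)
  have sf: "(\<Sum>x\<in>words m n. wt (f t) x) = (p j + t * (\<Sum>k\<in>{..<m} - {j}. p k)) ^ n" for t
  proof -
    have "(\<Sum>x\<in>words m n. wt (f t) x) = (sum (f t) {..<m}) ^ n"
      using sum_wt_lists[of "{..<m}" "f t" n] by (simp add: words_def conj_commute)
    also have "sum (f t) {..<m} = p j + (\<Sum>k\<in>{..<m} - {j}. t * p k)"
      using j by (subst sum.remove[of _ j]) (auto simp: f_def intro!: sum.cong)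
    finally show ?thesis by (simp add: sum_distrib_left)
  qed
  have wp: "0 \<le> wt p x" if "x \<in> words m n" for x
    using that p by (intro wt_nonneg) (auto simp: words_def)
  have "pair_prob p bad \<le> (\<Sum>(x, y)\<in>bad. C * (wt (f t) x * wt (f t') y))"
    unfolding pair_prob_def word_prob_eq_wt
  proof (rule sum_mono, clarify)
    fix x y assume xy: "(x, y) \<in> bad"
    hence "0 \<le> wt p x * wt p y" using bad by (auto intro!: wp mult_nonneg_nonneg)
    from mult_left_mono[OF wit[OF xy] this]
    show "wt p x * wt p y \<le> C * (wt (f t) x * wt (f t') y)"
      by (simp add: wf mult_ac)
  qed
  also have "\<dots> \<le> (\<Sum>(x, y)\<in>words m n \<times> words m n. C * (wt (f t) x * wt (f t') y))"
    using bad C t by (intro sum_mono2) (auto simp: finite_words wf intro!: mult_nonneg_nonneg wp)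
  also have "\<dots> = C * ((\<Sum>x\<in>words m n. wt (f t) x) * (\<Sum>y\<in>words m n. wt (f t') y))"
    by (subst sum_product, subst sum.cartesian_product, subst sum_distrib_left)
       (simp add: case_prod_unfold)
  finally show ?thesis by (simp add: sf power_mult_distrib)
qed

section \<open>Weights recording imbalance and deficit\<close>

definition gap_weight :: "'a \<Rightarrow> real \<Rightarrow> 'a list \<Rightarrow> 'a list \<Rightarrow> real" where
  "gap_weight j w u v = w ^ gap j u v"

lemma segprod_gap_weight: "segprod (gap_weight j w) ds e e' = w ^ imbalance j ds e e'"
  by (induction j ds e e' rule: imbalance.induct) (auto simp: gap_weight_def power_add)

text \<open>Split by which word has fewer majority letters; balanced pairs are counted twice, which
  only increases the bound.\<close>

lemma gap_weight_sum_le: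
  assumes q: "\<forall>k<m. 0 \<le> q k" and w: "0 \<le> w"
  shows "(\<Sum>u\<in>short_words m n. \<Sum>v\<in>short_words m n. gap_weight j w u v * wt q u * wt q v)
     \<le> 2 * ordered_sum m j w q q n"
proof -
  let ?W = "short_words m n"
  let ?f = "\<lambda>u v. of_bool (ones j u \<le> ones j v) * w ^ (ones j v - ones j u) * wt q u * wt q v"
  have "(\<Sum>u\<in>?W. \<Sum>v\<in>?W. gap_weight j w u v * wt q u * wt q v) \<le> (\<Sum>u\<in>?W. \<Sum>v\<in>?W. ?f u v + ?f v u)"
  proof (intro sum_mono)
    fix u v assume "u \<in> ?W" "v \<in> ?W"
    hence "0 \<le> wt q u * wt q v" using q by (intro mult_nonneg_nonneg wt_short_words_nonneg)
    thus "gap_weight j w u v * wt q u * wt q v \<le> ?f u v + ?f v u"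
      using w by (cases "ones j u" "ones j v" rule: linorder_cases)
        (auto simp: gap_weight_def gap_def mult_ac)
  qed
  also have "\<dots> = (\<Sum>u\<in>?W. \<Sum>v\<in>?W. ?f u v) + (\<Sum>v\<in>?W. \<Sum>u\<in>?W. ?f v u)"
    by (simp only: sum.distrib) (subst (2) sum.swap, simp)
  finally show ?thesis by (simp add: ordered_sum_def)
qed

text \<open>Multiplied over the segments, this records the imbalance with base \<open>w\<close> and
  the gaining replacements in both words with base \<open>t\<close>. A balanced pair contributes to
  neither; there the indicator of \<open>barren\<close> is \<open>1\<close> exactly when the pair is
  admissible.\<close>

definition deficit_weight :: "'a \<Rightarrow> real \<Rightarrow> real \<Rightarrow> 'a list \<Rightarrow> 'a list \<Rightarrow> real" where
  "deficit_weight j w t u v =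
     (if ones j u < ones j v then w ^ gap j u v * t ^ minor j u
      else if ones j v < ones j u then w ^ gap j u v * t ^ minor j v
      else of_bool (barren j u v))"

lemma segprod_deficit_weight:
  assumes "\<forall>(u, c, v)\<in>set ds. admissible j u v" "admissible j e e'"
  shows "segprod (deficit_weight j w t) ds e e' =
     w ^ imbalance j ds e e' * t ^ (deficit j ds e e' + deficit j (swap_segs ds) e' e)"
  using assms
  by (induction j ds e e' rule: imbalance.induct)
     (auto simp: deficit_weight_def gap_def power_add not_less dest!: antisym)

text \<open>The power of \<open>t\<close> is absorbed into the letter weights of the word with fewer
  majority letters; balanced pairs give the barren sum.\<close>

lemma deficit_weight_sum_le:
  assumes q: "\<forall>k<m. 0 \<le> q k" and w: "0 \<le> w" and t: "0 \<le> t"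
  shows "(\<Sum>u\<in>short_words m n. \<Sum>v\<in>short_words m n. deficit_weight j w t u v * wt q u * wt q v)
     \<le> 2 * ordered_sum m j w (\<lambda>k. if k = j then q k else t * q k) q n + barren_sum m j q n"
proof -
  let ?W = "short_words m n"
  define q' where "q' = (\<lambda>k. if k = j then q k else t * q k)"
  have wq: "wt q' x = wt q x * t ^ minor j x" for x
    by (induction x) (auto simp: q'_def)
  let ?f = "\<lambda>u v. of_bool (ones j u \<le> ones j v) * w ^ (ones j v - ones j u) * wt q' u * wt q v"
  let ?b = "\<lambda>u v. of_bool (ones j u = ones j v \<and> barren j u v) * (wt q u * wt q v)"
  have "(\<Sum>u\<in>?W. \<Sum>v\<in>?W. deficit_weight j w t u v * wt q u * wt q v)
      \<le> (\<Sum>u\<in>?W. \<Sum>v\<in>?W. (?f u v + ?f v u) + ?b u v)"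
  proof (intro sum_mono)
    fix u v assume uv: "u \<in> ?W" "v \<in> ?W"
    hence uv0: "0 \<le> wt q u" "0 \<le> wt q v" using q by (auto intro: wt_short_words_nonneg)
    show "deficit_weight j w t u v * wt q u * wt q v \<le> (?f u v + ?f v u) + ?b u v"
      using w uv0 t by (cases "ones j u" "ones j v" rule: linorder_cases)
        (auto simp: deficit_weight_def gap_def mult_ac wq)
  qed
  also have "\<dots> = ((\<Sum>u\<in>?W. \<Sum>v\<in>?W. ?f u v) + (\<Sum>v\<in>?W. \<Sum>u\<in>?W. ?f v u)) + (\<Sum>u\<in>?W. \<Sum>v\<in>?W. ?b u v)"
    unfolding sum.distrib by (subst (2) sum.swap) simp
  also have "(\<Sum>u\<in>?W. \<Sum>v\<in>?W. ?b u v) = barren_sum m j q n"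
  proof -
    have eq: "{(u, v). u \<in> ?W \<and> v \<in> ?W \<and> ones j u = ones j v \<and> barren j u v} =
        {x \<in> ?W \<times> ?W. ones j (fst x) = ones j (snd x) \<and> barren j (fst x) (snd x)}" by auto
    show ?thesis
      unfolding barren_sum_def eq
      by (subst sum.inter_filter, simp, subst sum.cartesian_product, intro sum.cong refl) auto
  qed
  finally show ?thesis by (simp add: ordered_sum_def q'_def)
qed

section \<open>Numerical estimates\<close>

lemma exp_minus_le: "0 \<le> (x::real) \<Longrightarrow> x \<le> 1 \<Longrightarrow> exp (- x) \<le> 1 - x + x\<^sup>2"
proof -
  assume x: "0 \<le> x" "x \<le> 1"
  \<comment> \<open>The product equals \<open>1 + x ^ 3\<close>.\<close>
  have "1 \<le> (1 - x + x\<^sup>2) * (1 + x)"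
    using x by (simp add: algebra_simps power2_eq_square) 
  also have "\<dots> \<le> (1 - x + x\<^sup>2) * exp x"
  proof (rule mult_left_mono)
    have "0 \<le> (1 - x)" "0 \<le> x\<^sup>2" using x by auto
    thus "0 \<le> 1 - x + x\<^sup>2" by linarith
  qed (rule exp_ge_add_one_self)
  finally show ?thesis by (simp add: exp_minus field_simps)
qed

text \<open>The damping \<open>s\<close> keeps \<open>t\<close> below \<open>1\<close> by at least
  \<open>24 * \<rho>\<close>, which controls the series in \<open>t * t\<close>. The final bound is
  such that the total weight per cut, with \<open>z = 8\<close>, is at most
  \<open>8 * \<rho> * (3 / (32 * \<rho>)) = 3/4\<close>.\<close>

lemma down_numerics:
  fixes r \<rho> :: real
  assumes r: "0 \<le> r" "r \<le> 1/1000" and \<rho>: "0 < \<rho>" "\<rho> \<le> 1/100000"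
    and s: "s = exp (- (25 * \<rho>))" and e: "e = s * r" and t: "t = s * (1 - r) / (1 - e)"
  shows "e < 1" "t * t < 1" "1/2 * t < 1"
    "2 * (1 / ((1 - e) * (1 - e) * (1 - t * t) * (1 - 1/2 * t))) \<le> 3 / (32 * \<rho>)"
proof -
  have "s \<le> 1 - 25 * \<rho> + (25 * \<rho>)\<^sup>2" unfolding s using \<rho> by (intro exp_minus_le) auto
  also have "(25 * \<rho>)\<^sup>2 \<le> \<rho>"
    using mult_left_mono[of "625 * \<rho>" 1 \<rho>] \<rho> by (simp add: power2_eq_square)
  finally have s1: "s \<le> 1 - 24 * \<rho>" by simp
  have "1 - 25 * \<rho> \<le> s" unfolding s using exp_ge_add_one_self[of "- (25 * \<rho>)"] by simp
  hence s2: "999/1000 \<le> s" using \<rho> by simp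
  have s3: "s \<le> 1" using s1 \<rho> by simp
  have e1: "0 \<le> e" "e \<le> 1/1000"
    unfolding e using mult_mono[of s 1 r "1/1000"] s2 s3 r by auto
  show "e < 1" using e1 by simp
  \<comment> \<open>Since \<open>e = s * r\<close>, the numerator \<open>1 - e - s * (1 - r)\<close>
    collapses to \<open>1 - s\<close>.\<close>
  have "1 - t = (1 - s) / (1 - e)" unfolding t using e1 by (simp add: e field_simps)
  moreover have "24 * \<rho> * (1 - e) \<le> 24 * \<rho> * 1"
    using \<rho> e1 by (intro mult_left_mono) auto
  hence "24 * \<rho> * (1 - e) \<le> 1 - s" using s1 by simp
  hence "24 * \<rho> \<le> (1 - s) / (1 - e)" using e1 by (simp add: pos_le_divide_eq)
  ultimately have t1: "t \<le> 1 - 24 * \<rho>" by simp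
  have "998/1000 \<le> s * (1 - r)"
    using mult_mono[of "999/1000" s "999/1000" "1 - r"] s2 r by simp
  also have "\<dots> = t * (1 - e)" using e1 by (simp add: t)
  also have "\<dots> \<le> t"
  proof -
    have "0 \<le> t" unfolding t using s2 r e1 by simp
    thus ?thesis using e1 mult_left_mono[of "1 - e" 1 t] by simp
  qed
  finally have t2: "998/1000 \<le> t" .
  have tt: "1 - t * t = (1 - t) * (1 + t)" by (simp add: algebra_simps)
  have t3: "47 * \<rho> \<le> 1 - t * t"
    unfolding tt using mult_mono[of "24 * \<rho>" "1 - t" "1998/1000" "1 + t"] t1 t2 \<rho> by simp
  show "t * t < 1" using t3 \<rho> by simp
  have t4: "1/2 \<le> 1 - 1/2 * t" using t1 \<rho> by simp
  show "1/2 * t < 1" using t4 by simp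
  have ee: "998/1000 \<le> (1 - e) * (1 - e)"
    using mult_mono[of "999/1000" "1 - e" "999/1000" "1 - e"] e1 by simp
  have "998/1000 * (47 * \<rho>) * (1/2) \<le> (1 - e) * (1 - e) * (1 - t * t) * (1 - 1/2 * t)"
    using ee t3 t4 \<rho> e1 by (intro mult_mono mult_nonneg_nonneg) auto
  hence "64 * \<rho> / 3 \<le> (1 - e) * (1 - e) * (1 - t * t) * (1 - 1/2 * t)"
    using \<rho> by simp
  hence "1 / ((1 - e) * (1 - e) * (1 - t * t) * (1 - 1/2 * t)) \<le> 1 / (64 * \<rho> / 3)"
    using \<rho> by (intro frac_le[OF zero_le_one order_refl]) simp_all
  thus "2 * (1 / ((1 - e) * (1 - e) * (1 - t * t) * (1 - 1/2 * t))) \<le> 3 / (32 * \<rho>)"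
    by (simp add: field_simps)
qed

text \<open>Here \<open>s > 1\<close>, so \<open>t\<close> may exceed \<open>1\<close> by a small
  multiple of \<open>\<rho>\<close>. For unbalanced pairs the damping \<open>y\<close> compensates:
  \<open>t' * t\<close> stays below \<open>1\<close> by \<open>50000 * \<rho>\<close>, and these
  pairs contribute only \<open>1 / (1000 * \<rho>)\<close>. For balanced pairs the missing common
  blocks cost nearly \<open>4 * \<rho>\<close>, against a growth of \<open>t ^ 4\<close> by at most
  \<open>9/10 * \<rho>\<close>.\<close>

lemma up_numerics:
  fixes r \<rho> y :: real
  assumes r: "0 \<le> r" "r \<le> 1/1000" and \<rho>: "0 < \<rho>" "\<rho> \<le> 1/100000"
    and y: "0 \<le> y" "y \<le> 1" "100000 * \<rho> \<le> r * (1 - y)"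
    and s: "s = exp (\<rho> / 5)" and e: "e = s * r" and t: "t = s * (1 - r) / (1 - e)"
    and e': "e' = y * (s * r)" and t': "t' = s * (1 - r) / (1 - e')"
  shows "e < 1" "e' < 1" "t' * t < 1" "19/20 * t < 1"
    "2 * (1 / ((1 - e') * (1 - e) * (1 - t' * t) * (1 - 19/20 * t))) \<le> 1 / (1000 * \<rho>)"
    "(1 / (1 - e))\<^sup>2 + (t / (1 - e))\<^sup>2 \<le> (201/100)"
    "(s * (1 - r))\<^sup>2 * ((t / (1 - e))\<^sup>2 - 4 * (s * (1 - r))\<^sup>2 * (s\<^sup>2 * \<rho>)) \<le> 1 - 3 * \<rho>"
    "400/361 * s\<^sup>2 * \<rho> * (7 / (10 * \<rho>)) \<le> 4/5"
proof -
  have "s \<le> 1 + \<rho> / 5 + (\<rho> / 5)\<^sup>2" unfolding s using \<rho> by (intro exp_bound) auto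
  also have "(\<rho> / 5)\<^sup>2 \<le> \<rho> / 1000"
    using mult_left_mono[of \<rho> "1/100000" \<rho>] \<rho> by (simp add: power2_eq_square)
  finally have s1: "s \<le> 1 + (201/1000) * \<rho>" by simp
  have s2: "1 \<le> s" unfolding s using \<rho> by simp
  have s3: "s \<le> (100001/100000)" using s1 \<rho> by simp
  have e1: "0 \<le> e" "e \<le> (11/10000)"
    unfolding e using mult_mono[of s "(100001/100000)" r "1/1000"] s2 s3 r by auto
  have e'1: "0 \<le> e'" "e' \<le> e"
    unfolding e' e using mult_right_mono[of y 1 "s * r"] s2 r y by auto
  show "e < 1" "e' < 1" using e1 e'1 by auto
  have "t - 1 = (s - 1) / (1 - e)" unfolding t using e1 by (simp add: e field_simps)
  also have "\<dots> \<le> ((201/1000) * \<rho>) / (9989/10000)"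
    using s1 s2 e1 \<rho> by (intro frac_le) auto
  also have "\<dots> \<le> (21/100) * \<rho>" using \<rho> by simp
  finally have t1: "t \<le> 1 + (21/100) * \<rho>" by simp
  have t0: "0 \<le> t" "0 \<le> t'" unfolding t t' using s2 r e1 e'1 by auto
  define \<kappa> where "\<kappa> = r * (1 - y)"
  have \<kappa>: "100000 * \<rho> \<le> \<kappa>" using y by (simp add: \<kappa>_def)
  have "1 - t' = (s * \<kappa> - (s - 1)) / (1 - e')"
    unfolding t' using e1 e'1 by (simp add: e' \<kappa>_def field_simps)
  moreover have "\<kappa> - (201/1000) * \<rho> \<le> (s * \<kappa> - (s - 1)) / (1 - e')"
  proof -
    have a: "\<kappa> - (201/1000) * \<rho> \<le> s * \<kappa> - (s - 1)"
      using mult_right_mono[of 1 s \<kappa>] s1 s2 \<kappa> \<rho> by linarith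
    have "(\<kappa> - (201/1000) * \<rho>) * (1 - e') \<le> (\<kappa> - (201/1000) * \<rho>) * 1"
      using \<kappa> \<rho> e'1 by (intro mult_left_mono) auto
    thus ?thesis using a e1 e'1 by (simp add: pos_le_divide_eq)
  qed
  ultimately have t'1: "t' \<le> 1 - (\<kappa> - (201/1000) * \<rho>)" by simp
  have "t' * t \<le> t' * (1 + (21/100) * \<rho>)" using t0 t1 by (intro mult_left_mono) auto
  also have "\<dots> \<le> t' + (21/100) * \<rho>"
  proof -
    have "t' * ((21/100) * \<rho>) \<le> 1 * ((21/100) * \<rho>)"
      using t'1 \<kappa> \<rho> by (intro mult_right_mono) auto
    thus ?thesis by (simp add: distrib_left)
  qed
  finally have tt: "50000 * \<rho> \<le> 1 - t' * t" using t'1 \<kappa> \<rho> by simp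
  show "t' * t < 1" using tt \<rho> by simp
  have wt: "(49/1000) \<le> 1 - 19/20 * t" using t1 \<rho> by simp
  show "19/20 * t < 1" using wt by simp
  have "(99/100) * (99/100) * (50000 * \<rho>) * (49/1000) \<le> (1 - e') * (1 - e) * (1 - t' * t) * (1 - 19/20 * t)"
    using e1 e'1 tt wt \<rho> by (intro mult_mono mult_nonneg_nonneg) auto
  hence "2000 * \<rho> \<le> (1 - e') * (1 - e) * (1 - t' * t) * (1 - 19/20 * t)" using \<rho> by simp
  hence "1 / ((1 - e') * (1 - e) * (1 - t' * t) * (1 - 19/20 * t)) \<le> 1 / (2000 * \<rho>)"
    using \<rho> by (intro frac_le[OF zero_le_one order_refl]) simp_all
  thus "2 * (1 / ((1 - e') * (1 - e) * (1 - t' * t) * (1 - 19/20 * t))) \<le> 1 / (1000 * \<rho>)"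
    by (simp add: field_simps)
  have te: "t / (1 - e) \<le> (2503/2500)" "1 / (1 - e) \<le> (2503/2500)"
    using e1 t0 t1 \<rho> by (auto simp: pos_divide_le_eq)
  have "(t / (1 - e))\<^sup>2 \<le> (2503/2500)\<^sup>2" "(1 / (1 - e))\<^sup>2 \<le> (2503/2500)\<^sup>2"
    using te t0 e1 by (intro power_mono; simp)+
  moreover have "(2503/2500)\<^sup>2 + (2503/2500)\<^sup>2 \<le> ((201/100) :: real)" by (simp add: power2_eq_square)
  ultimately show "(1 / (1 - e))\<^sup>2 + (t / (1 - e))\<^sup>2 \<le> (201/100)" by linarith
  have ct: "(s * (1 - r))\<^sup>2 * (t / (1 - e))\<^sup>2 = t ^ 4"
    unfolding t by (simp add: power2_eq_square power4_eq_xxxx mult_ac)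
  have rr: "\<rho> * \<rho> \<le> \<rho> / 100000"
    using mult_left_mono[of \<rho> "1/100000" \<rho>] \<rho> by simp
  have "t\<^sup>2 \<le> (1 + (21/100) * \<rho>)\<^sup>2" using t0 t1 by (intro power_mono) auto
  also have "\<dots> \<le> 1 + (17/40) * \<rho>"
  proof -
    have "(1 + (21/100) * \<rho>)\<^sup>2 = 1 + (21/50) * \<rho> + (441/10000) * (\<rho> * \<rho>)"
      by (simp add: power2_eq_square algebra_simps)
    thus ?thesis using rr \<rho> by linarith
  qed
  finally have "(t\<^sup>2)\<^sup>2 \<le> (1 + (17/40) * \<rho>)\<^sup>2" by (intro power_mono) auto
  also have "\<dots> \<le> 1 + (9/10) * \<rho>"
  proof -
    have "(1 + (17/40) * \<rho>)\<^sup>2 = 1 + (17/20) * \<rho> + (289/1600) * (\<rho> * \<rho>)"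
      by (simp add: power2_eq_square algebra_simps)
    thus ?thesis using rr \<rho> by linarith
  qed
  finally have t4: "t ^ 4 \<le> 1 + (9/10) * \<rho>" by (simp add: power_mult[symmetric])
  have c1: "(999/1000) \<le> s * (1 - r)" using mult_mono[of 1 s "(999/1000)" "1 - r"] s2 r by simp
  have c4: "(99/100) \<le> (s * (1 - r)) ^ 4"
  proof -
    have "(99/100) \<le> (999/1000 :: real) ^ 4" by (simp add: power4_eq_xxxx)
    also have "\<dots> \<le> (s * (1 - r)) ^ 4" using c1 by (intro power_mono) auto
    finally show ?thesis .
  qed
  have "1 \<le> s\<^sup>2" using s2 by simp
  hence "(99/100) * (4 * (1 * \<rho>)) \<le> (s * (1 - r)) ^ 4 * (4 * (s\<^sup>2 * \<rho>))"
    using c4 \<rho> by (intro mult_mono mult_left_mono mult_right_mono) auto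
  moreover have "(s * (1 - r))\<^sup>2 * ((t / (1 - e))\<^sup>2 - 4 * (s * (1 - r))\<^sup>2 * (s\<^sup>2 * \<rho>))
      = t ^ 4 - (s * (1 - r)) ^ 4 * (4 * (s\<^sup>2 * \<rho>))"
  proof -
    have "c\<^sup>2 * (a - 4 * c\<^sup>2 * b) = c\<^sup>2 * a - c ^ 4 * (4 * b)" for a b c :: real
      by (simp add: power2_eq_square power4_eq_xxxx algebra_simps)
    thus ?thesis unfolding ct[symmetric] .
  qed
  ultimately show "(s * (1 - r))\<^sup>2 * ((t / (1 - e))\<^sup>2 - 4 * (s * (1 - r))\<^sup>2 * (s\<^sup>2 * \<rho>)) \<le> 1 - 3 * \<rho>"
    using t4 \<rho> by linarith
  have "s\<^sup>2 \<le> (100001/100000)\<^sup>2" using s2 s3 by (intro power_mono) auto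
  thus "400/361 * s\<^sup>2 * \<rho> * (7 / (10 * \<rho>)) \<le> 4/5"
    using \<rho> by (simp add: power2_eq_square)
qed

section \<open>The exceptional events\<close>

lemma pair_prob_nonneg_term:
  assumes "\<forall>k<m. 0 \<le> p k" "(x, y) \<in> words m n \<times> words m n"
  shows "0 \<le> word_prob p x * word_prob p y"
  using assms unfolding word_prob_eq_wt
  by (intro mult_nonneg_nonneg wt_nonneg) (auto simp: words_def)

lemma pair_prob_mono:
  assumes "\<forall>k<m. 0 \<le> p k" "A \<subseteq> B" "B \<subseteq> words m n \<times> words m n"
  shows "pair_prob p A \<le> pair_prob p B"
  unfolding pair_prob_def
proof (rule sum_mono2)
  show "finite B" using assms(3) finite_words by (meson finite_SigmaI finite_subset)
  show "0 \<le> (\<lambda>(x, y). word_prob p x * word_prob p y) b" if "b \<in> B - A" for b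
    using that assms pair_prob_nonneg_term[OF assms(1)] by (cases b) auto
qed fact

lemma pair_prob_Un_le:
  assumes "\<forall>k<m. 0 \<le> p k" "A \<subseteq> words m n \<times> words m n" "B \<subseteq> words m n \<times> words m n"
  shows "pair_prob p (A \<union> B) \<le> pair_prob p A + pair_prob p B"
proof -
  have fin: "finite A" "finite B" using assms finite_words by (meson finite_SigmaI finite_subset)+
  have "pair_prob p (A \<union> B) = pair_prob p A + pair_prob p (B - A)"
    using sum.union_disjoint[of A "B - A"] fin by (auto simp: pair_prob_def)
  also have "pair_prob p (B - A) \<le> pair_prob p B" using assms by (intro pair_prob_mono) auto
  finally show ?thesis by simp
qed

lemma pair_prob_all:
  assumes "(\<Sum>k<m. p k) = 1"
  shows "pair_prob p (words m n \<times> words m n) = 1"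
proof -
  have "(\<Sum>x\<in>words m n. word_prob p x) = 1"
    using sum_wt_lists[of "{..<m}" p n] assms by (simp add: words_def word_prob_eq_wt conj_commute)
  thus ?thesis by (simp add: pair_prob_def sum.cartesian_product[symmetric] sum_distrib_left[symmetric])
qed

text \<open>Chernoff bound from \<open>1 + r * (exp c - 1) \<le> exp (r * (exp c - 1))\<close>. The
  rates \<open>a\<close> and \<open>b\<close> may have any sign, so upper tails, lower tails and
  differences of the two minority counts are all covered.\<close>

lemma minor_chernoff:
  fixes p :: "nat \<Rightarrow> real"
  assumes p: "\<forall>k<m. 0 \<le> p k" and sum1: "(\<Sum>k<m. p k) = 1" and j: "j < m"
    and bad: "bad \<subseteq> words m n \<times> words m n"
    and wit: "\<And>x y. (x, y) \<in> bad \<Longrightarrow> d \<le> a * real (minor j x) + b * real (minor j y)"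
  shows "pair_prob p bad \<le> exp (real n * (\<Sum>k\<in>{..<m} - {j}. p k) * (exp a + exp b - 2) - d)"
proof -
  define r where "r = (\<Sum>k\<in>{..<m} - {j}. p k)"
  have r0: "0 \<le> r" unfolding r_def using p by (intro sum_nonneg) auto
  have pj: "p j = 1 - r" using sum1 j by (simp add: r_def sum.remove[of "{..<m}" j])
  have pj0: "0 \<le> p j" using p j by simp
  have "pair_prob p bad \<le> exp (- d) * ((p j + exp a * r) * (p j + exp b * r)) ^ n"
    unfolding r_def
  proof (rule minor_markov[OF p j bad])
    fix x y assume "(x, y) \<in> bad"
    hence "1 \<le> exp (a * real (minor j x) + b * real (minor j y) - d)" using wit by simp
    thus "1 \<le> exp (- d) * (exp a ^ minor j x * exp b ^ minor j y)"
      by (simp add: exp_of_nat2_mult[symmetric] exp_add exp_diff exp_minus field_simps)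
  qed auto
  also have "\<dots> \<le> exp (- d) * (exp (r * (exp a - 1)) * exp (r * (exp b - 1))) ^ n"
  proof -
    have "p j + exp c * r \<le> exp (r * (exp c - 1))" for c
      using exp_ge_add_one_self[of "r * (exp c - 1)"] by (simp add: pj algebra_simps)
    thus ?thesis using pj0 r0
      by (intro mult_left_mono power_mono mult_mono mult_nonneg_nonneg add_nonneg_nonneg) auto
  qed
  also have "\<dots> = exp (real n * r * (exp a + exp b - 2) - d)"
    by (simp add: exp_add[symmetric] exp_of_nat_mult[symmetric] algebra_simps)
  finally show ?thesis by (simp add: r_def)
qed

text \<open>A loss probability above \<open>\<delta>\<close> forces at least
  \<open>97 * n * \<rho>\<close> cuts, and alignments with so many cuts are exponentially
  unlikely.\<close>

lemma bad_down_bound: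
  fixes p :: "nat \<Rightarrow> real"
  assumes p: "\<forall>k<m. 0 \<le> p k" and sum1: "(\<Sum>k<m. p k) = 1" and j: "j < m"
    and r_def: "r = (\<Sum>k\<in>{..<m} - {j}. p k)" and \<rho>_def: "\<rho> = (\<Sum>k\<in>{..<m} - {j}. (p k)\<^sup>2)"
    and r: "r \<le> 1/1000" and \<rho>: "0 < \<rho>" "\<rho> \<le> 1/100000"
    and bad: "bad \<subseteq> words m n \<times> words m n"
    and gap: "\<And>x y. (x, y) \<in> bad \<Longrightarrow> real (gap j x y) \<le> real n * \<rho>"
    and N: "\<And>x y. (x, y) \<in> bad \<Longrightarrow> 194 * real n * \<rho> \<le> real (minor j x + minor j y) * \<delta>"
    and down: "\<And>x y. (x, y) \<in> bad \<Longrightarrow> \<delta> < lcs_change_prob j x y (-1)"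
    and N0: "\<And>x y. (x, y) \<in> bad \<Longrightarrow> 0 < minor j x + minor j y"
  shows "pair_prob p bad \<le> exp (- (real n * \<rho>)) * (1 / \<rho>)"
proof -
  have r0: "0 \<le> r" unfolding r_def using p by (intro sum_nonneg) auto
  have pj: "p j = 1 - r" using sum1 j by (simp add: r_def sum.remove[of "{..<m}" j])
  define s where "s = exp (- (25 * \<rho>))"
  have s0: "0 < s" by (simp add: s_def)
  have s1: "s \<le> 1" using \<rho> by (simp add: s_def)
  define q where "q = (\<lambda>k. s * p k)"
  have q: "\<forall>k<m. 0 \<le> q k" using p s0 by (auto simp: q_def)
  have e: "s * r = (\<Sum>k\<in>{..<m} - {j}. q k)" by (simp add: r_def q_def sum_distrib_left)
  note num = down_numerics[OF r0 r \<rho> s_def refl refl]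
  \<comment> \<open>Imbalance has base \<open>1/2\<close> and each cut gets \<open>z = 8\<close>.
    The part \<open>2 * length ds\<close> of the imbalance bound uses up a factor \<open>4\<close>
    per cut; the remaining \<open>2\<close> per cut pays for the small prefactor.\<close>
  have "pair_prob p bad \<le> exp (- (57 * real n * \<rho>)) * (1 / s) ^ (2 * n) * (3 / (32 * \<rho>) / (1 - 3/4))"
  proof (rule decomposition_union_bound[OF p bad, where \<theta> = "gap_weight j (1/2)" and z = 8 and j = j])
    have "(\<Sum>u\<in>short_words m n. \<Sum>v\<in>short_words m n. gap_weight j (1/2) u v * wt q u * wt q v)
        \<le> 2 * ordered_sum m j (1/2) q q n" by (rule gap_weight_sum_le[OF q]) simp
    also have "\<dots> \<le> 3 / (32 * \<rho>)"
      using ordered_sum_le[OF q q j, of "1/2" "s * r" "s * r" _ _ n, OF _ e _ e _ refl refl] num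
      by (simp add: q_def pj)
    finally show "(\<Sum>u\<in>short_words m n. \<Sum>v\<in>short_words m n.
        gap_weight j (1/2) u v * wt (\<lambda>k. s * p k) u * wt (\<lambda>k. s * p k) v) \<le> 3 / (32 * \<rho>)"
      by (simp add: q_def)
    have "s\<^sup>2 \<le> 1" using s0 s1 by (simp add: power_le_one)
    thus "8 * s\<^sup>2 * (\<Sum>k\<in>{..<m} - {j}. (p k)\<^sup>2) * (3 / (32 * \<rho>)) \<le> 3/4"
      using \<rho> by (simp add: \<rho>_def[symmetric])
  next
    fix x y assume xy: "(x, y) \<in> bad"
    obtain ds e e' where d: "x = lword ds e" "y = rword ds e'" "matched_minor j ds"
      "score j ds e e' = lcs_len x y"
      using lcs_decomposition[of x y j] by blast
    define M where "M = real (minor j x + minor j y)"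
    have M: "0 < M" using N0[OF xy] unfolding M_def by (simp only: of_nat_0_less_iff)
    have "\<delta> < lcs_change_prob j x y (-1)" by (rule down[OF xy])
    also have "\<dots> \<le> real (2 * length ds) / M"
      unfolding lcs_change_prob_def card_positions M_def
      by (intro divide_right_mono of_nat_mono card_down_positions[OF d(4,1,2)]) simp
    finally have "M * \<delta> \<le> real (2 * length ds)" using M by (simp add: field_simps)
    hence len: "97 * real n * \<rho> \<le> real (length ds)" using N[OF xy] by (simp add: M_def)
    have imb: "imbalance j ds e e' \<le> 2 * length ds + gap j x y"
      using imbalance_le[OF d(3)] d by simp
    have "exp (57 * real n * \<rho>) \<le> exp (real (length ds) * (3/5)) / 2 ^ gap j x y"
    proof -
      have "ln 2 \<le> (1::real)" using ln_le_minus_one[of "2::real"] by simp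
      hence "real (gap j x y) * ln 2 \<le> real n * \<rho> * 1"
        using gap[OF xy] \<rho> by (intro mult_mono) auto
      \<comment> \<open>The constant comes from \<open>97 * 3/5 - 1 \<ge> 57\<close>, the
        \<open>1\<close> being the cost of the global gap.\<close>
      hence "57 * real n * \<rho> \<le> real (length ds) * (3/5) - real (gap j x y) * ln 2"
        using len mult_nonneg_nonneg[OF of_nat_0_le_iff less_imp_le[OF \<rho>(1)], of n] by linarith
      hence "exp (57 * real n * \<rho>) \<le> exp (real (length ds) * (3/5) - real (gap j x y) * ln 2)" by simp
      also have "\<dots> = exp (real (length ds) * (3/5)) / 2 ^ gap j x y"
        by (simp add: exp_diff exp_of_nat_mult)
      finally show ?thesis .
    qed
    also have "\<dots> \<le> 2 ^ length ds / 2 ^ gap j x y"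
    proof (rule divide_right_mono)
      have "exp (3/5) \<le> (2::real)"
        using exp_bound[of "3/5 :: real"] by (simp add: power2_eq_square)
      thus "exp (real (length ds) * (3/5)) \<le> 2 ^ length ds"
        unfolding exp_of_nat_mult by (intro power_mono) auto
    qed simp
    also have "\<dots> = 8 ^ length ds * (1/2) ^ (2 * length ds + gap j x y)"
    proof -
      have "(8::real) ^ k * (1/2) ^ (2 * k) = 2 ^ k" for k
        by (simp add: power_mult power_mult_distrib[symmetric] power2_eq_square)
      from this[of "length ds"] show ?thesis
        by (simp only: power_add mult.assoc[symmetric]) (simp add: power_one_over)
    qed
    also have "\<dots> \<le> 8 ^ length ds * (1/2) ^ imbalance j ds e e'"
      using imb by (intro mult_left_mono power_decreasing) auto
    finally have "1 \<le> exp (- (57 * real n * \<rho>)) * (8 ^ length ds * segprod (gap_weight j (1/2)) ds e e')"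
      by (simp add: segprod_gap_weight exp_minus field_simps)
    thus "\<exists>ds e e'. x = lword ds e \<and> y = rword ds e' \<and> matched_minor j ds \<and>
        1 \<le> exp (- (57 * real n * \<rho>)) * (8 ^ length ds * segprod (gap_weight j (1/2)) ds e e')"
      using d by blast
  qed (use s0 in \<open>auto simp: gap_weight_def\<close>)
  also have "(1 / s) ^ (2 * n) = exp (50 * real n * \<rho>)"
    by (simp add: s_def exp_minus inverse_eq_divide exp_of_nat_mult[symmetric] mult_ac)
  \<comment> \<open>The exponent is \<open>-7 * n * \<rho>\<close>, more than what is claimed, and
    the last factor is \<open>3 / (8 * \<rho>)\<close>.\<close>
  also have "exp (- (57 * real n * \<rho>)) * exp (50 * real n * \<rho>) * (3 / (32 * \<rho>) / (1 - 3/4)) \<le>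
      exp (- (real n * \<rho>)) * (1 / \<rho>)"
    using \<rho> unfolding exp_add[symmetric]
    by (intro mult_mono) (auto simp: field_simps)
  finally show ?thesis .
qed

text \<open>Few gaining replacements mean a small deficit, so damping each of them by
  \<open>exp (- \<mu>)\<close> costs little. The same damping makes unbalanced pairs negligible in
  the sum, and the barren condition makes balanced ones rare.\<close>

lemma bad_up_bound:
  fixes p :: "nat \<Rightarrow> real"
  assumes p: "\<forall>k<m. 0 \<le> p k" and sum1: "(\<Sum>k<m. p k) = 1" and j: "j < m" and n: "2 \<le> n"
    and r_def: "r = (\<Sum>k\<in>{..<m} - {j}. p k)" and \<rho>_def: "\<rho> = (\<Sum>k\<in>{..<m} - {j}. (p k)\<^sup>2)"
    and r: "r \<le> 1/1000" and \<rho>: "0 < \<rho>" "\<rho> \<le> 1/100000"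
    and bad: "bad \<subseteq> words m n \<times> words m n"
    and gap: "\<And>x y. (x, y) \<in> bad \<Longrightarrow> real (gap j x y) \<le> real n * \<rho>"
    and \<mu>: "0 \<le> \<mu>" "100000 * \<rho> \<le> r * (1 - exp (- \<mu>))"
    and N: "\<And>x y. (x, y) \<in> bad \<Longrightarrow> \<mu> * (\<epsilon> * real (minor j x + minor j y)) \<le> real n * \<rho> / 10"
    and up: "\<And>x y. (x, y) \<in> bad \<Longrightarrow> lcs_change_prob j x y 1 < \<epsilon>"
    and N0: "\<And>x y. (x, y) \<in> bad \<Longrightarrow> 0 < minor j x + minor j y"
  shows "pair_prob p bad \<le> exp (- (real n * \<rho> / 5)) * (7 / (2 * \<rho>))"
proof -
  have r0: "0 \<le> r" unfolding r_def using p by (intro sum_nonneg) auto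
  have pj: "p j = 1 - r" using sum1 j by (simp add: r_def sum.remove[of "{..<m}" j])
  define s where "s = exp (\<rho> / 5)"
  define y0 where "y0 = exp (- \<mu>)"
  have y0: "0 \<le> y0" "y0 \<le> 1" "100000 * \<rho> \<le> r * (1 - y0)" using \<mu> by (auto simp: y0_def)
  have s0: "0 < s" by (simp add: s_def)
  define q where "q = (\<lambda>k. s * p k)"
  define q' where "q' = (\<lambda>k. if k = j then q k else y0 * q k)"
  have q: "\<forall>k<m. 0 \<le> q k" using p s0 by (auto simp: q_def)
  have q': "\<forall>k<m. 0 \<le> q' k" using q y0 by (auto simp: q'_def)
  define e where "e = s * r"
  define e' where "e' = y0 * (s * r)"
  define t where "t = s * (1 - r) / (1 - e)"
  define t' where "t' = s * (1 - r) / (1 - e')"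
  have eq: "e = (\<Sum>k\<in>{..<m} - {j}. q k)" by (simp add: e_def r_def q_def sum_distrib_left)
  have e'q: "e' = (\<Sum>k\<in>{..<m} - {j}. q' k)"
    by (auto simp: e'_def r_def q_def q'_def sum_distrib_left intro!: sum.cong)
  have tq: "t = q j / (1 - e)" "t' = q' j / (1 - e')"
    by (simp_all add: t_def t'_def q_def q'_def pj)
  note num = up_numerics[OF r0 r \<rho> y0 s_def e_def t_def e'_def t'_def]
  have barren: "barren_sum m j q n \<le> 67 / (100 * \<rho>)"
  proof -
    define Z where "Z = barren_sum m j q n"
    have Z0: "0 \<le> Z" unfolding Z_def barren_sum_def
      by (intro sum_nonneg) (auto intro!: mult_nonneg_nonneg wt_short_words_nonneg[OF q])
    have g0: "ones_gf m j q n 0 ^ 2 \<le> (1 / (1 - e))\<^sup>2"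
      using ones_gf_le[OF q j eq num(1), of n 0] ones_gf_nonneg[OF q]
      by (intro power_mono) (simp_all add: tq)
    have g1: "ones_gf m j q n 1 ^ 2 \<le> (t / (1 - e))\<^sup>2"
      using ones_gf_le[OF q j eq num(1), of n 1] ones_gf_nonneg[OF q]
      by (intro power_mono) (simp_all add: tq)
    have "(\<Sum>k\<in>{..<m} - {j}. (q k)\<^sup>2) = s\<^sup>2 * \<rho>"
      by (simp add: q_def \<rho>_def power_mult_distrib sum_distrib_left)
    hence "block_sum m j q n \<le> (t / (1 - e))\<^sup>2 - 4 * (s * (1 - r))\<^sup>2 * (s\<^sup>2 * \<rho>)"
      using block_sum_le[OF q n j] g1 by (simp add: q_def pj)
    hence "(q j)\<^sup>2 * block_sum m j q n \<le>
        (s * (1 - r))\<^sup>2 * ((t / (1 - e))\<^sup>2 - 4 * (s * (1 - r))\<^sup>2 * (s\<^sup>2 * \<rho>))"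
      unfolding q_def pj by (intro mult_left_mono) auto
    also have "\<dots> \<le> 1 - 3 * \<rho>" by (rule num)
    finally have "(q j)\<^sup>2 * block_sum m j q n * Z \<le> (1 - 3 * \<rho>) * Z"
      using Z0 by (rule mult_right_mono)
    \<comment> \<open>The recursion has \<open>Z\<close> on both sides. As \<open>Z\<close> is a
      finite sum it can be solved, giving \<open>3 * \<rho> * Z \<le> 201/100\<close>.\<close>
    hence "Z \<le> (201/100) + (1 - 3 * \<rho>) * Z"
      using barren_sum_le[OF q, of j n] g0 g1 num(6) unfolding Z_def by linarith
    hence "\<rho> * Z \<le> 67/100" by (simp add: algebra_simps)
    thus ?thesis using \<rho> by (simp add: Z_def field_simps)
  qed
  \<comment> \<open>The value \<open>z = 400/361 = (20/19)^2\<close> exactly offsets the imbalance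
    of up to \<open>2\<close> per cut, weighted with base \<open>19/20\<close>. The gain comes from
    \<open>s > 1\<close>: the factor \<open>(1 / s) ^ (2 * n)\<close> outweighs the
    prefactor.\<close>
  have "pair_prob p bad \<le> exp (real n * \<rho> / 5) * (1 / s) ^ (2 * n) * (7 / (10 * \<rho>) / (1 - 4/5))"
  proof (rule decomposition_union_bound[OF p bad, where \<theta> = "deficit_weight j (19/20) y0"
        and z = "400/361" and j = j])
    have "(\<Sum>u\<in>short_words m n. \<Sum>v\<in>short_words m n. deficit_weight j (19/20) y0 u v * wt q u * wt q v)
        \<le> 2 * ordered_sum m j (19/20) q' q n + barren_sum m j q n"
      unfolding q'_def using y0 by (intro deficit_weight_sum_le[OF q]) auto
    also have "2 * ordered_sum m j (19/20) q' q n \<le> 1 / (1000 * \<rho>)"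
      using ordered_sum_le[OF q q' j _ eq num(1) e'q num(2) tq num(3,4), of n] num(5) by linarith
    also have "1 / (1000 * \<rho>) + barren_sum m j q n \<le> 1 / (1000 * \<rho>) + 67 / (100 * \<rho>)"
      using barren by simp
    also have "\<dots> \<le> 7 / (10 * \<rho>)" using \<rho> by (simp add: field_simps)
    finally show "(\<Sum>u\<in>short_words m n. \<Sum>v\<in>short_words m n.
        deficit_weight j (19/20) y0 u v * wt (\<lambda>k. s * p k) u * wt (\<lambda>k. s * p k) v) \<le> 7 / (10 * \<rho>)"
      by (simp add: q_def)
    show "400/361 * s\<^sup>2 * (\<Sum>k\<in>{..<m} - {j}. (p k)\<^sup>2) * (7 / (10 * \<rho>)) \<le> 4/5"
      using num(8) by (simp only: \<rho>_def[symmetric])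
    show "0 \<le> deficit_weight j (19/20) y0 u v" for u v
      using y0 by (simp add: deficit_weight_def)
  next
    fix x y assume xy: "(x, y) \<in> bad"
    obtain ds e e' where d: "x = lword ds e" "y = rword ds e'" "matched_minor j ds"
      "score j ds e e' = lcs_len x y" "\<forall>(u, c, v)\<in>set ds. admissible j u v" "admissible j e e'"
      using lcs_decomposition[of x y j] by blast
    define M where "M = real (minor j x + minor j y)"
    have M: "0 < M" using N0[OF xy] unfolding M_def by (simp only: of_nat_0_less_iff)
    define D where "D = deficit j ds e e' + deficit j (swap_segs ds) e' e"
    have "real D / M \<le> lcs_change_prob j x y 1"
      unfolding lcs_change_prob_def card_positions M_def D_def
      by (intro divide_right_mono of_nat_mono card_up_positions[OF d(4,1,2)]) simp
    also have "\<dots> < \<epsilon>" by (rule up[OF xy])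
    finally have "real D \<le> \<epsilon> * M" using M by (simp add: field_simps)
    hence "\<mu> * real D \<le> \<mu> * (\<epsilon> * M)" using \<mu> by (intro mult_left_mono)
    hence D: "\<mu> * real D \<le> real n * \<rho> / 10" using N[OF xy] by (simp add: M_def)
    have imb: "imbalance j ds e e' \<le> 2 * length ds + gap j x y"
      using imbalance_le[OF d(3)] d by simp
    \<comment> \<open>The gap costs at most \<open>n * \<rho> / 19\<close> and the deficit at most
      \<open>n * \<rho> / 10\<close>, together less than \<open>n * \<rho> / 5\<close>.\<close>
    have "exp (- (real n * \<rho> / 5)) \<le> exp (real (gap j x y) * (- (1/19))) * exp (real D * (- \<mu>))"
      using gap[OF xy] D unfolding exp_add[symmetric] by (simp add: algebra_simps)
    also have "\<dots> \<le> (19/20) ^ gap j x y * y0 ^ D"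
    proof -
      have "exp (- (1/19)) \<le> (19/20 :: real)"
        using exp_ge_add_one_self[of "1/19 :: real"] by (simp add: exp_minus field_simps)
      thus ?thesis unfolding exp_of_nat_mult y0_def by (intro mult_right_mono power_mono) auto
    qed
    also have "\<dots> = (400/361) ^ length ds * ((19/20) ^ (2 * length ds + gap j x y) * y0 ^ D)"
    proof -
      have "(400/361 :: real) ^ k * (19/20) ^ (2 * k) = 1" for k
        by (simp add: power_mult power_mult_distrib[symmetric] power2_eq_square)
      thus ?thesis by (simp add: power_add mult.assoc[symmetric])
    qed
    also have "\<dots> \<le> (400/361) ^ length ds * ((19/20) ^ imbalance j ds e e' * y0 ^ D)"
      using imb y0 by (intro mult_left_mono mult_right_mono power_decreasing) auto
    finally have "1 \<le> exp (real n * \<rho> / 5) * ((400/361) ^ length ds * segprod (deficit_weight j (19/20) y0) ds e e')"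
      unfolding segprod_deficit_weight[OF d(5,6)] D_def[symmetric]
      by (simp add: exp_minus field_simps)
    thus "\<exists>ds e e'. x = lword ds e \<and> y = rword ds e' \<and> matched_minor j ds \<and>
        1 \<le> exp (real n * \<rho> / 5) * ((400/361) ^ length ds * segprod (deficit_weight j (19/20) y0) ds e e')"
      using d by blast
  qed (use s0 in auto)
  also have "(1 / s) ^ (2 * n) = exp (- (2 * real n * \<rho> / 5))"
    by (simp add: s_def exp_minus inverse_eq_divide exp_of_nat_mult[symmetric] power_one_over mult_ac)
  also have "exp (real n * \<rho> / 5) * exp (- (2 * real n * \<rho> / 5)) = exp (- (real n * \<rho> / 5))"
    unfolding exp_add[symmetric] by simp
  finally show ?thesis by simp
qed

lemma gap_eq_minor:
  "length x = length y \<Longrightarrow> real (gap j x y) = \<bar>real (minor j x) - real (minor j y)\<bar>"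
  using ones_add_minor[of x j] ones_add_minor[of y j] by (auto simp: gap_def)

lemma Kconst_bounds:
  assumes "2 \<le> m"
  shows "0 < Kconst m" "Kconst m \<le> 1 / 10000000"
proof -
  show "0 < Kconst m" using assms by (simp add: Kconst_def)
  have "(2::real) powr (-4) * 10 powr (-2) * exp (-67) \<le> 1 * 1 * exp (-67)"
    by (intro mult_mono) (auto simp: powr_minus_divide)
  also have "\<dots> = 1 / exp 1 ^ 67"
    by (simp add: exp_of_nat_mult[symmetric] exp_minus inverse_eq_divide)
  also have "\<dots> \<le> 1 / 2 ^ 67"
    using exp_ge_add_one_self[of 1] by (intro divide_left_mono power_mono) auto
  also have "\<dots> \<le> (1 / 10000000 :: real)" by simp
  finally show "Kconst m \<le> 1 / 10000000" by (simp add: Kconst_def)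
qed

section \<open>Choice of the parameters and the final count\<close>

theorem theorem2p1:
  fixes m j0 n :: nat and p :: "nat \<Rightarrow> real"
  assumes "m \<ge> 2"
    and "\<forall>k<m. p k \<ge> 0"
    and "(\<Sum>k<m. p k) = 1"
    and "j0 < m"
    and "p j0 > 1/2"
    and "pmax_other m p j0 \<le>
           min (2 powr (-2) * exp (-5) * Kconst m / real m) (Kconst m / (2 * (real m)^2))"
    and "n \<ge> 1"
  shows "\<exists>B \<subseteq> words m n \<times> words m n.
           pair_prob p B \<ge> 1 - 121 * exp (- (real n * (pmax_other m p j0)^6) / 5) \<and>
           (\<forall>(x, y)\<in>B. lcs_change_prob j0 x y 1 \<ge> Kconst m / real m \<and>
                        lcs_change_prob j0 x y (-1) \<le> Kconst m / (2 * real m))"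
proof -
  define q where "q = pmax_other m p j0"
  define K where "K = Kconst m"
  define E where "E = real n * q ^ 6 / 5"
  have p: "\<forall>k<m. 0 \<le> p k" and sum1: "(\<Sum>k<m. p k) = 1" and j: "j0 < m" by fact+
  let ?J = "{..<m} - {j0}"
  have "?J \<noteq> {}"
  proof -
    have "card ?J = m - 1" using j by simp
    thus ?thesis using assms(1) by (metis card.empty diff_is_0_eq not_less_eq_eq one_add_one plus_1_eq_Suc)
  qed
  hence qmem: "q \<in> p ` ?J" and qmax: "\<And>k. k \<in> ?J \<Longrightarrow> p k \<le> q"
    unfolding q_def pmax_other_def by (auto intro!: Max_in simp del: image_is_empty)
  have q0: "0 \<le> q" using qmem p by auto
  have K: "0 < K" "K \<le> 1 / 10000000" using Kconst_bounds[OF assms(1)] by (auto simp: K_def)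
  \<comment> \<open>A letter is a minority letter with probability \<open>r\<close>, and two
    independent letters are equal minority letters with probability \<open>\<rho>\<close>. The next
    bounds tie both to \<open>q\<close>.\<close>
  define r where "r = (\<Sum>k\<in>?J. p k)"
  define \<rho> where "\<rho> = (\<Sum>k\<in>?J. (p k)\<^sup>2)"
  have rm: "r \<le> real m * q"
  proof -
    have "r \<le> real (card ?J) * q" unfolding r_def using qmax by (intro sum_bounded_above) auto
    also have "\<dots> \<le> real m * q" using q0 j by (intro mult_right_mono) auto
    finally show ?thesis .
  qed
  have qr: "q \<le> r"
    using qmem p unfolding r_def by (auto intro!: member_le_sum)
  have q\<rho>: "q\<^sup>2 \<le> \<rho>"
    using qmem unfolding \<rho>_def by (auto intro!: member_le_sum)
  have \<rho>qr: "\<rho> \<le> q * r"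
    unfolding \<rho>_def r_def sum_distrib_left power2_eq_square
    using qmax p by (intro sum_mono mult_right_mono) auto
  have mpos: "0 < real m" using assms(1) by simp
  have Kq: "388 * (real m * q) \<le> K"
  proof -
    \<comment> \<open>This gives \<open>388 = 4 * 97\<close>; it turns \<open>K / (2 * m)\<close>
      into at least \<open>194 * q\<close>, the threshold used for the losing event.\<close>
    have "(97::real) \<le> (5/2) ^ 5" by (simp add: power_divide)
    also have "\<dots> \<le> exp 1 ^ 5"
      using exp_lower_Taylor_quadratic[of 1] by (intro power_mono) auto
    also have "\<dots> = exp 5" by (simp add: exp_of_nat_mult[symmetric])
    finally have e5: "97 \<le> exp (5::real)" .
    have "q \<le> 2 powr (-2) * exp (-5) * K / real m" using assms(6) by (simp add: q_def K_def)
    also have "\<dots> = K / (4 * real m * exp 5)"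
      by (simp add: powr_minus_divide exp_minus field_simps)
    finally have "q * (4 * real m * exp 5) \<le> K"
      using mpos by (simp add: pos_le_divide_eq)
    moreover have "(4 * (real m * q)) * 97 \<le> (4 * (real m * q)) * exp 5"
      using e5 q0 by (intro mult_left_mono) auto
    ultimately show ?thesis by (simp add: mult_ac)
  qed
  have r: "r \<le> 1/1000000" using rm Kq K by simp
  have q1: "q \<le> 1/1000000" using qr r by simp
  show ?thesis
  proof (cases "E \<le> 4")
    \<comment> \<open>Since \<open>exp 4 \<le> 81 < 121\<close>, the required probability is not
      positive, and the empty set suffices.\<close>
    case True
    have "exp (4::real) = exp 1 ^ 4" by (simp add: exp_of_nat_mult[symmetric])
    also have "\<dots> \<le> 3 ^ 4" using exp_le by (intro power_mono) auto
    finally have "1 \<le> 121 * exp (-4 :: real)" by (simp add: exp_minus field_simps)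
    also have "\<dots> \<le> 121 * exp (- E)" using True by simp
    finally show ?thesis
      by (intro exI[of _ "{}"]) (auto simp: pair_prob_def E_def q_def)
  next
    case False
    hence E4: "20 \<le> real n * q ^ 6" by (simp add: E_def)
    have qpos: "0 < q" using E4 q0 by (cases "q = 0") auto
    have rpos: "0 < r" using qpos qr by simp
    have \<rho>pos: "0 < \<rho>" using qpos q\<rho> by (smt (verit) zero_less_power)
    have npos: "0 < real n" using assms(7) by simp
    have n2: "2 \<le> n"
    proof -
      have "q ^ 6 \<le> 1" using q0 q1 by (intro power_le_one) auto
      hence "real n * q ^ 6 \<le> real n * 1" by (intro mult_left_mono) auto
      thus ?thesis using E4 by simp
    qed
    have \<rho>1: "\<rho> \<le> 1/100000"
    proof -
      have "q * r \<le> 1/1000000 * 1" using q0 q1 r rpos by (intro mult_mono) auto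
      thus ?thesis using \<rho>qr by simp
    qed
    have q6: "q ^ 6 \<le> r" "q ^ 6 \<le> q ^ 4 / 1000" "q ^ 6 \<le> \<rho> / 1000" "q ^ 4 \<le> \<rho>\<^sup>2"
    proof -
      have "q ^ 6 \<le> q ^ 1" using q0 q1 by (intro power_decreasing) auto
      thus "q ^ 6 \<le> r" using qr by simp
      have "q\<^sup>2 \<le> q ^ 1" using q0 q1 by (intro power_decreasing) auto
      hence "q\<^sup>2 \<le> 1/1000" using q1 by simp
      hence "q ^ 4 * q\<^sup>2 \<le> q ^ 4 * (1/1000)" using q0 by (intro mult_left_mono) auto
      thus *: "q ^ 6 \<le> q ^ 4 / 1000" by (simp add: power_add[symmetric])
      have "q ^ 4 \<le> q\<^sup>2" using q0 q1 by (intro power_decreasing) auto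
      thus "q ^ 6 \<le> \<rho> / 1000" using * q\<rho> by simp
      have "(q\<^sup>2)\<^sup>2 \<le> \<rho>\<^sup>2" using q\<rho> by (intro power_mono) auto
      thus "q ^ 4 \<le> \<rho>\<^sup>2" by simp
    qed
    define X where "X = exp (- E)"
    define W where "W = words m n \<times> words m n"
    define N where "N = (\<lambda>x y. real (minor j0 x + minor j0 y))"
    \<comment> \<open>The number \<open>N\<close> of minority letters has mean
      \<open>2 * n * r\<close>; \<open>b1\<close> and \<open>b2\<close> are deviations by a factor
      of two. Next, \<open>b3\<close> and \<open>b4\<close> bound the global gap, and
      \<open>b5\<close> and \<open>b6\<close> are the losing and gaining failures on typical
      pairs.\<close>
    define b1 where "b1 = {(x, y) \<in> W. 4 * real n * r < N x y}"
    define b2 where "b2 = {(x, y) \<in> W. N x y < real n * r}"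
    define b3 where "b3 = {(x, y) \<in> W. real n * \<rho> < real (minor j0 x) - real (minor j0 y)}"
    define b4 where "b4 = {(x, y) \<in> W. real n * \<rho> < real (minor j0 y) - real (minor j0 x)}"
    define b5 where "b5 = {(x, y) \<in> W. real n * r \<le> N x y \<and> real (gap j0 x y) \<le> real n * \<rho> \<and>
      K / (2 * real m) < lcs_change_prob j0 x y (-1)}"
    define b6 where "b6 = {(x, y) \<in> W. real n * r \<le> N x y \<and> N x y \<le> 4 * real n * r \<and>
      real (gap j0 x y) \<le> real n * \<rho> \<and> lcs_change_prob j0 x y 1 < K / real m}"
    define B where "B = {(x, y) \<in> W. K / real m \<le> lcs_change_prob j0 x y 1 \<and>
      lcs_change_prob j0 x y (-1) \<le> K / (2 * real m)}"
    have sub: "b1 \<subseteq> W" "b2 \<subseteq> W" "b3 \<subseteq> W" "b4 \<subseteq> W" "b5 \<subseteq> W" "b6 \<subseteq> W" "B \<subseteq> W"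
      by (auto simp: b1_def b2_def b3_def b4_def b5_def b6_def B_def)
    note chernoff = minor_chernoff[OF p sum1 j, folded r_def]
    have nr: "0 < real n * r" using npos rpos by simp
    have Enr: "E \<le> real n * r / 5"
      unfolding E_def using q6(1) npos by (intro divide_right_mono mult_left_mono) auto
    have E\<rho>: "E \<le> real n * \<rho> / 10"
      unfolding E_def using mult_left_mono[OF q6(3), of "real n"] mult_pos_pos[OF npos \<rho>pos] by simp
    have E\<rho>2: "E \<le> real n * \<rho>\<^sup>2 / 8"
    proof -
      have "q ^ 6 / 5 \<le> \<rho>\<^sup>2 / 8" using q6(2,4) zero_le_power[OF q0, of 6] by linarith
      hence "real n * (q ^ 6 / 5) \<le> real n * (\<rho>\<^sup>2 / 8)" using npos by (intro mult_left_mono) auto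
      thus ?thesis by (simp add: E_def)
    qed
    have P1: "pair_prob p b1 \<le> X"
    proof -
      \<comment> \<open>Rates \<open>1/2\<close>: the exponent is at most
        \<open>(3/2 - 2) * n * r\<close>.\<close>
      have "pair_prob p b1 \<le> exp (real n * r * (exp (1/2) + exp (1/2) - 2) - 2 * real n * r)"
        by (rule chernoff[OF sub(1)[unfolded W_def]]) (auto simp: b1_def N_def)
      also have "real n * r * (exp (1/2) + exp (1/2) - 2) \<le> real n * r * (3/2)"
        using nr exp_bound[of "1/2"] by (intro mult_left_mono) (auto simp: power2_eq_square)
      also have "exp (real n * r * (3/2) - 2 * real n * r) \<le> X"
        unfolding X_def exp_le_cancel_iff using Enr nr by linarith
      finally show ?thesis by simp
    qed
    have P2: "pair_prob p b2 \<le> X"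
    proof -
      \<comment> \<open>Rates \<open>-1\<close>: the exponent is at most
        \<open>(1 - 6/5) * n * r\<close>, just enough for \<open>E\<close>.\<close>
      have "pair_prob p b2 \<le> exp (real n * r * (exp (-1) + exp (-1) - 2) - (- (real n * r)))"
        by (rule chernoff[OF sub(2)[unfolded W_def]]) (auto simp: b2_def N_def)
      also have "exp (-1) \<le> (2/5 :: real)"
        using exp_lower_Taylor_quadratic[of 1] by (simp add: exp_minus field_simps)
      hence "real n * r * (exp (-1) + exp (-1) - 2) \<le> real n * r * (-6/5)"
        using nr by (intro mult_left_mono) auto
      hence "exp (real n * r * (exp (-1) + exp (-1) - 2) - (- (real n * r))) \<le> X"
        unfolding X_def exp_le_cancel_iff using Enr nr by linarith
      finally show ?thesis by simp
    qed
    \<comment> \<open>With opposite rates the linear terms cancel, leaving a second-order cost that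
      the threshold term \<open>n * \<rho>\<^sup>2 / 4\<close> beats.\<close>
    have cosh: "exp (\<rho> / 4) + exp (- (\<rho> / 4)) - 2 \<le> \<rho>\<^sup>2 / 8"
      using exp_bound[of "\<rho> / 4"] exp_minus_le[of "\<rho> / 4"] \<rho>pos \<rho>1
      by (simp add: power2_eq_square)
    have P34_exp: "exp (real n * r * (exp (\<rho> / 4) + exp (- (\<rho> / 4)) - 2) - real n * \<rho>\<^sup>2 / 4) \<le> X"
    proof -
      have "real n * r * (exp (\<rho> / 4) + exp (- (\<rho> / 4)) - 2) \<le> real n * r * (\<rho>\<^sup>2 / 8)"
        using cosh nr by (intro mult_left_mono) auto
      also have "\<dots> \<le> real n * 1 * (\<rho>\<^sup>2 / 8)"
        using r by (intro mult_right_mono mult_left_mono) auto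
      finally show ?thesis unfolding X_def exp_le_cancel_iff using E\<rho>2 by linarith
    qed
    have P3: "pair_prob p b3 \<le> X"
    proof (rule order_trans[OF _ P34_exp], rule chernoff[OF sub(3)[unfolded W_def]])
      fix x y assume "(x, y) \<in> b3"
      hence "\<rho> / 4 * (real n * \<rho>) \<le> \<rho> / 4 * (real (minor j0 x) - real (minor j0 y))"
        using \<rho>pos by (intro mult_left_mono) (auto simp: b3_def)
      thus "real n * \<rho>\<^sup>2 / 4 \<le> \<rho> / 4 * real (minor j0 x) + - (\<rho> / 4) * real (minor j0 y)"
        by (simp add: power2_eq_square algebra_simps)
    qed
    have P4: "pair_prob p b4 \<le> X"
    proof -
      have "pair_prob p b4 \<le> exp (real n * r * (exp (- (\<rho> / 4)) + exp (\<rho> / 4) - 2) - real n * \<rho>\<^sup>2 / 4)"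
      proof (rule chernoff[OF sub(4)[unfolded W_def]])
        fix x y assume "(x, y) \<in> b4"
        hence "\<rho> / 4 * (real n * \<rho>) \<le> \<rho> / 4 * (real (minor j0 y) - real (minor j0 x))"
          using \<rho>pos by (intro mult_left_mono) (auto simp: b4_def)
        thus "real n * \<rho>\<^sup>2 / 4 \<le> - (\<rho> / 4) * real (minor j0 x) + \<rho> / 4 * real (minor j0 y)"
          by (simp add: power2_eq_square algebra_simps)
      qed
      thus ?thesis using P34_exp by (simp add: add.commute)
    qed
    have tail: "exp (- (real n * \<rho> / 5)) * (1 / \<rho>) \<le> 10 * X"
    proof -
      \<comment> \<open>This absorbs the polynomial factor:
        \<open>1 / \<rho> \<le> n * \<rho> \<le> 10 * exp (n * \<rho> / 10)\<close>.\<close>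
      have "1 \<le> real n * \<rho>\<^sup>2"
      proof -
        have "real n * q ^ 6 \<le> real n * \<rho>\<^sup>2"
          using q6(2,4) zero_le_power[OF q0, of 6] by (intro mult_left_mono; linarith)
        thus ?thesis using E4 by simp
      qed
      hence "1 / \<rho> \<le> real n * \<rho>" using \<rho>pos by (simp add: power2_eq_square field_simps)
      also have "\<dots> \<le> 10 * exp (real n * \<rho> / 10)"
        using exp_ge_add_one_self[of "real n * \<rho> / 10"] by linarith
      finally have "exp (- (real n * \<rho> / 5)) * (1 / \<rho>) \<le>
          exp (- (real n * \<rho> / 5)) * (10 * exp (real n * \<rho> / 10))"
        by (intro mult_left_mono) auto
      also have "\<dots> = 10 * exp (- (real n * \<rho> / 10))" by (simp add: exp_add[symmetric])
      also have "\<dots> \<le> 10 * X" unfolding X_def using E\<rho> by simp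
      finally show ?thesis .
    qed
    have r3: "r \<le> 1/1000" using r by simp
    have Npos: "0 < minor j0 x + minor j0 y" if "real n * r \<le> N x y" for x y
    proof -
      have "0 < N x y" using that nr by linarith
      thus ?thesis unfolding N_def by (simp only: of_nat_0_less_iff)
    qed
    have P5: "pair_prob p b5 \<le> 10 * X"
    proof -
      have "pair_prob p b5 \<le> exp (- (real n * \<rho>)) * (1 / \<rho>)"
      proof (rule bad_down_bound[OF p sum1 j r_def \<rho>_def r3 \<rho>pos \<rho>1 sub(5)[unfolded W_def],
            where \<delta> = "K / (2 * real m)"])
        fix x y assume "(x, y) \<in> b5"
        hence NN: "real n * r \<le> N x y" and g: "real (gap j0 x y) \<le> real n * \<rho>"
          and c: "K / (2 * real m) < lcs_change_prob j0 x y (-1)" by (auto simp: b5_def)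
        show "real (gap j0 x y) \<le> real n * \<rho>" "K / (2 * real m) < lcs_change_prob j0 x y (-1)"
          by fact+
        show "0 < minor j0 x + minor j0 y" using Npos NN .
        have "194 * real n * \<rho> \<le> 194 * real n * (q * r)" using \<rho>qr npos by (intro mult_left_mono) auto
        also have "\<dots> = real n * r * (194 * q)" by simp
        also have "\<dots> \<le> N x y * (K / (2 * real m))"
          using NN nr q0 Kq mpos by (intro mult_mono) (auto simp: field_simps)
        finally show "194 * real n * \<rho> \<le> real (minor j0 x + minor j0 y) * (K / (2 * real m))"
          by (simp add: N_def)
      qed
      also have "\<dots> \<le> exp (- (real n * \<rho> / 5)) * (1 / \<rho>)"
        using \<rho>pos npos by (intro mult_right_mono) auto
      finally show ?thesis using tail by simp
    qed
    have P6: "pair_prob p b6 \<le> 35 * X"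
    proof -
      \<comment> \<open>Chosen so that damping \<open>K / m\<close> of at most
        \<open>4 * n * r\<close> positions costs exactly \<open>n * \<rho> / 10\<close>. The
        smallness of \<open>K\<close> still makes \<open>r * \<mu>\<close> a large multiple of
        \<open>\<rho>\<close>.\<close>
      define \<mu> where "\<mu> = \<rho> * real m / (40 * K * r)"
      have \<mu>0: "0 \<le> \<mu>" using \<rho>pos rpos K by (simp add: \<mu>_def)
      have \<mu>1: "\<mu> \<le> 1/2"
      proof -
        have "\<rho> * real m \<le> q * r * real m" using \<rho>qr by (intro mult_right_mono) auto
        also have "\<dots> = (real m * q) * r" by simp
        also have "\<dots> \<le> K * r" using Kq mult_nonneg_nonneg[OF less_imp_le[OF mpos] q0] rpos
          by (intro mult_right_mono) linarith+
        also have "\<dots> \<le> 1/2 * (40 * K * r)" using K rpos by simp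
        finally show ?thesis using K rpos by (simp add: \<mu>_def pos_divide_le_eq)
      qed
      have "exp (- \<mu>) \<le> 1 - \<mu> + \<mu>\<^sup>2" using \<mu>0 \<mu>1 by (intro exp_minus_le) auto
      also have "\<mu>\<^sup>2 \<le> \<mu> / 2" using mult_left_mono[OF \<mu>1 \<mu>0] by (simp add: power2_eq_square)
      finally have "r * (\<mu> / 2) \<le> r * (1 - exp (- \<mu>))" using rpos by (intro mult_left_mono) auto
      moreover have "r * (\<mu> / 2) = \<rho> * (real m / (80 * K))" using rpos K by (simp add: \<mu>_def)
      moreover have "100000 \<le> real m / (80 * K)"
        using K assms(1) by (simp add: pos_le_divide_eq)
      hence "\<rho> * 100000 \<le> \<rho> * (real m / (80 * K))" using \<rho>pos by (intro mult_left_mono) auto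
      ultimately have \<mu>2: "100000 * \<rho> \<le> r * (1 - exp (- \<mu>))" by simp
      have "pair_prob p b6 \<le> exp (- (real n * \<rho> / 5)) * (7 / (2 * \<rho>))"
      proof (rule bad_up_bound[OF p sum1 j n2 r_def \<rho>_def r3 \<rho>pos \<rho>1 sub(6)[unfolded W_def] _ \<mu>0 \<mu>2,
            where \<epsilon> = "K / real m"])
        fix x y assume "(x, y) \<in> b6"
        hence NN: "real n * r \<le> N x y" "N x y \<le> 4 * real n * r"
          and g: "real (gap j0 x y) \<le> real n * \<rho>"
          and c: "lcs_change_prob j0 x y 1 < K / real m" by (auto simp: b6_def)
        show "real (gap j0 x y) \<le> real n * \<rho>" "lcs_change_prob j0 x y 1 < K / real m"
          by fact+
        show "0 < minor j0 x + minor j0 y" using Npos NN(1) .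
        have "\<mu> * (K / real m * N x y) \<le> \<mu> * (K / real m * (4 * real n * r))"
          using NN \<mu>0 K by (intro mult_left_mono) auto
        also have "\<dots> = real n * \<rho> / 10" using K rpos mpos by (simp add: \<mu>_def field_simps)
        finally show "\<mu> * (K / real m * real (minor j0 x + minor j0 y)) \<le> real n * \<rho> / 10"
          by (simp add: N_def)
      qed
      also have "\<dots> = 7/2 * (exp (- (real n * \<rho> / 5)) * (1 / \<rho>))" by simp
      also have "\<dots> \<le> 7/2 * (10 * X)" using tail by (intro mult_left_mono) auto
      finally show ?thesis by simp
    qed
    have cover: "W \<subseteq> B \<union> (b1 \<union> (b2 \<union> (b3 \<union> (b4 \<union> (b5 \<union> b6)))))"
    proof
      fix w assume w: "w \<in> W"
      obtain x y where xy: "w = (x, y)" by (cases w)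
      have "length x = length y" using w by (auto simp: xy W_def words_def)
      note g = gap_eq_minor[OF this, of j0]
      show "w \<in> B \<union> (b1 \<union> (b2 \<union> (b3 \<union> (b4 \<union> (b5 \<union> b6)))))"
      proof (rule ccontr)
        assume c: "w \<notin> B \<union> (b1 \<union> (b2 \<union> (b3 \<union> (b4 \<union> (b5 \<union> b6)))))"
        have NN: "N x y \<le> 4 * real n * r" "real n * r \<le> N x y"
          and gg: "real (gap j0 x y) \<le> real n * \<rho>"
          using c w unfolding xy g b1_def b2_def b3_def b4_def by auto
        have "K / real m \<le> lcs_change_prob j0 x y 1" "lcs_change_prob j0 x y (-1) \<le> K / (2 * real m)"
          using c w NN gg unfolding xy b5_def b6_def by auto
        thus False using c w unfolding xy B_def by auto
      qed
    qed
    have "1 = pair_prob p W" unfolding W_def by (rule pair_prob_all[OF sum1, symmetric])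
    also have "\<dots> \<le> pair_prob p (B \<union> (b1 \<union> (b2 \<union> (b3 \<union> (b4 \<union> (b5 \<union> b6))))))"
      using sub unfolding W_def by (intro pair_prob_mono[OF p cover[unfolded W_def]]) simp
    also have "\<dots> \<le> pair_prob p B + (pair_prob p b1 + (pair_prob p b2 + (pair_prob p b3 +
        (pair_prob p b4 + (pair_prob p b5 + pair_prob p b6)))))"
      using sub unfolding W_def
      by (intro order_trans[OF pair_prob_Un_le[OF p]] add_left_mono order_refl) simp_all
    \<comment> \<open>The six events cost \<open>1 + 1 + 1 + 1 + 10 + 35 = 49\<close> times
      \<open>X\<close>.\<close>
    finally have "1 - 121 * X \<le> pair_prob p B"
      using P1 P2 P3 P4 P5 P6 exp_gt_zero[of "- E"] unfolding X_def by linarith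
    thus ?thesis
      using sub(7) by (intro exI[of _ B]) (auto simp: X_def E_def q_def K_def W_def B_def)
  qed
qed

end
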